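(* Fix an integer $d\geq 2$ and a partition $\mu=(\mu_1,\dots,\mu_l)$ of $d$ (so $l=l(\mu)$). Then there exist rational numbers $\vec{C}(\mu;k,i)\in\mathbb{Q}$, for $1\leq k\leq d-1$ and $1\leq i\leq \lfloor (d-1)/k\rfloor$, independent of $g$, such that for every genus $g\in\mathbb{Z}_{\geq 0}$, \[ \mu_1\cdots\mu_l\cdot\vec{H}_{g;\mu} =\sum_{k=1}^{d-1}\ \sum_{1\leq i\leq \lfloor (d-1)/k\rfloor} \Big(\vec{C}(\mu;k,i)\cdot (2g-2+d+l)^{i-1} \cdot k^{2g-2+d+l}\Big). \]
   Context: A partition $\mu=(\mu_1,\dots,\mu_l)$ of $d$ is a weakly decreasing sequence of positive integers with sum $d$; $l=l(\mu)$ is its length. Let $m_j(\mu)=\#\{i:\mu_i=j\}$ and $|\mathrm{Aut}(\mu)|=\prod_{j\geq1} m_j(\mu)!$. For a partition $\mu$ of $d$, $C_\mu\subset S_d$ denotes the conjugacy class of permutations with cycle lengths $\mu_1,\dots,\mu_l$; $C_{(2,1^{d-2})}$ is the class of transpositions. For $g\geq 0$ set $b=2g-2+d+l(\mu)$. The connected monotone Hurwitz number is \[ \vec{H}_{g;\mu}=\frac{|\mathrm{Aut}(\mu)|}{d!}\cdot\#\{(\sigma_1,\dots,\sigma_{b+1}) : \sigma_1\in C_\mu,\ \sigma_i\in C_{(2,1^{d-2})}\ (2\leq i\leq b+1),\ \sigma_1\sigma_2\cdots\sigma_{b+1}=\mathrm{id},\ \langle\sigma_1,\dots,\sigma_{b+1}\rangle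 \text{ acts transitively on }\{1,\dots,d\},\ B_2\leq B_3\leq\cdots\leq B_{b+1}\}, \] where for $2\leq i\leq b+1$ one writes the transposition $\sigma_i=(A_i,B_i)$ with $A_i<B_i$. *)

theory Defs
  imports
    Complex_Main
    "HOL-Library.Multiset"
    "HOL-Combinatorics.Orbits"
    "HOL-Algebra.Sym_Groups"
    "HOL-Algebra.Generated_Groups"
    "HOL-Algebra.Group_Action"
begin

definition partition_of :: "nat list \<Rightarrow> nat \<Rightarrow> bool" where
  "partition_of \<mu> d \<longleftrightarrow>
     sorted_wrt (\<ge>) \<mu> \<and> (\<forall>x\<in>set \<mu>. 0 < x) \<and> sum_list \<mu> = d"

(* |Aut(mu)|; parts j that do not occur in mu would contribute the factor 0! = 1. *)
definition aut_card :: "nat list \<Rightarrow> nat" where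
  "aut_card \<mu> = (\<Prod>j\<in>set \<mu>. fact (count_list \<mu> j))"

(* The cycles of p, fixed points included, are its orbits on {1..d};
   both Orbits and Group_Action define a constant named orbit. *)
definition cycle_lengths :: "nat \<Rightarrow> (nat \<Rightarrow> nat) \<Rightarrow> nat multiset" where
  "cycle_lengths d p = image_mset card (mset_set (Orbits.orbit p ` {1..d}))"

definition cycle_class :: "nat \<Rightarrow> nat list \<Rightarrow> (nat \<Rightarrow> nat) set" where
  "cycle_class d \<mu> = {p \<in> carrier (sym_group d). cycle_lengths d p = mset \<mu>}"

abbreviation transpositions :: "nat \<Rightarrow> (nat \<Rightarrow> nat) set" where
  "transpositions d \<equiv> cycle_class d (2 # replicate (d - 2) 1)"

(* Group_Action asks for a homomorphism into BijGroup {1..d}, whose elements are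
   extensional functions; hence the restriction of p to {1..d}. *)
definition generates_transitive :: "nat \<Rightarrow> (nat \<Rightarrow> nat) set \<Rightarrow> bool" where
  "generates_transitive d S \<longleftrightarrow>
     transitive_action ((sym_group d)\<lparr>carrier := generate (sym_group d) S\<rparr>)
       {1..d} (\<lambda>p. restrict p {1..d})"

(* The tuple (sigma_1, ..., sigma_(b+1)) is a list, so sigma_i is \<sigma> ! (i - 1).
   Permutations are multiplied as functions, from right to left. The opposite convention
   gives the same number of tuples (replace sigma_1 by its inverse). *)
definition monotone_factorizations ::
  "nat \<Rightarrow> nat list \<Rightarrow> nat \<Rightarrow> (nat \<Rightarrow> nat) list set" where
  "monotone_factorizations d \<mu> b =
     {\<sigma>. length \<sigma> = b + 1 \<and>
          \<sigma> ! 0 \<in> cycle_class d \<mu> \<and>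
          (\<forall>i\<in>{2..b + 1}. \<sigma> ! (i - 1) \<in> transpositions d) \<and>
          foldr (mult (sym_group d)) \<sigma> (one (sym_group d)) = id \<and>
          generates_transitive d (set \<sigma>) \<and>
          (\<exists>A B. (\<forall>i\<in>{2..b + 1}. A i < B i \<and> \<sigma> ! (i - 1) = transpose (A i) (B i)) \<and>
                 (\<forall>i\<in>{2..b}. B i \<le> B (i + 1)))}"

(* b = 2g - 2 + d + l(mu). The 2 is subtracted last because subtraction on nat truncates;
   for d \<ge> 2 no truncation occurs. *)
definition num_transpositions :: "nat \<Rightarrow> nat list \<Rightarrow> nat" where
  "num_transpositions g \<mu> = 2 * g + sum_list \<mu> + length \<mu> - 2"

definition monotone_hurwitz :: "nat \<Rightarrow> nat list \<Rightarrow> rat" where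
  "monotone_hurwitz g \<mu> =
     of_nat (aut_card \<mu>) / fact (sum_list \<mu>) *
     of_nat (card (monotone_factorizations (sum_list \<mu>) \<mu> (num_transpositions g \<mu>)))"

end

theory Submission
  imports
    Defs
    "HOL-Library.Poly_Mapping"
    "HOL-Computational_Algebra.Formal_Power_Series"
    "HOL-Computational_Algebra.Polynomial"
begin

text \<open>
  Monotone products of \<open>b\<close> transpositions in the symmetric group of an \<open>n\<close>-element set are the
  terms of the complete homogeneous polynomial \<open>h\<^sub>b\<close> in the Jucys--Murphy elements. These commute
  and are self-adjoint, so the rational group algebra is spanned by joint eigenvectors, on which
  \<open>\<Sum> h\<^sub>b z\<^sup>b\<close> becomes \<open>\<Prod> 1/(1 - a\<^sub>i z)\<close> for an integral content sequence \<open>a\<close>. As in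
  the Okounkov--Vershik approach, before every occurrence of \<open>k > 0\<close> and after the previous one
  there is an occurrence of \<open>k - 1\<close>; hence \<open>k\<close> has multiplicity at most \<open>(n - 1)/k\<close>, which bounds the
  order of the pole at \<open>1/k\<close> (and symmetrically for \<open>k < 0\<close>).

  Splitting a monotone factorization along the component of a fixed point multiplies
  generating functions: an interleaving of two weakly increasing sequences without common values is
  unique. Since the bounds \<open>(m - 1) + (n - 1) < m + n\<close> on pole orders add up, the transitive
  factorizations satisfy the same bound. Finally, \<open>b\<close> has the parity of \<open>d + l(\<mu>)\<close>, so that
  the contributions of \<open>k\<close> and \<open>-k\<close> combine.
\<close>

section \<open>Jucys--Murphy operators and their content sequences\<close>

text \<open>The operators \<open>s i\<close> stand for adjacent transpositions acting by isometries
  of \<open>B\<close>. Anisotropy of \<open>B\<close> takes the place of positive definiteness: it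
  excludes Jordan blocks over the rationals.\<close>

locale jucys_murphy = vector_space scale
  for scale :: "rat \<Rightarrow> 'v::ab_group_add \<Rightarrow> 'v" (infixr "*s" 75) +
  fixes s :: "nat \<Rightarrow> 'v \<Rightarrow> 'v" and B :: "'v \<Rightarrow> 'v \<Rightarrow> rat"
  assumes s_add: "s i (u + v) = s i u + s i v"
    and s_scale: "s i (c *s v) = c *s s i v"
    and s_s: "s i (s i v) = v"
    and s_comm: "Suc i < j \<Longrightarrow> s i (s j v) = s j (s i v)"
    and braid: "s i (s (Suc i) (s i v)) = s (Suc i) (s i (s (Suc i) v))"
    and B_sym: "B u v = B v u"
    and B_add: "B (u + w) v = B u v + B w v"
    and B_scale: "B (c *s u) v = c * B u v"
    and B_pos: "B v v = 0 \<Longrightarrow> v = 0"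
    and B_s: "B (s i u) (s i v) = B u v"
begin

lemma s_minus: "s i (- v) = - s i v"
  using s_scale[of i "-1" v] by simp

lemma s_diff: "s i (u - v) = s i u - s i v"
  using s_add[of i u "- v"] by (simp add: s_minus)

lemma s_zero [simp]: "s i 0 = 0"
  using s_diff[of i 0 0] by simp

lemma B_minus: "B (- u) v = - B u v"
  using B_scale[of "-1" u v] by simp

lemma B_diff: "B (u - w) v = B u v - B w v"
  using B_add[of u "- w" v] by (simp add: B_minus)

lemma B_add_right: "B v (u + w) = B v u + B v w"
  by (metis B_sym B_add)

lemma B_diff_right: "B v (u - w) = B v u - B v w"
  by (metis B_sym B_diff)

lemma B_scale_right: "B v (c *s u) = c * B v u"
  by (metis B_sym B_scale)

lemma B_s_left: "B (s i u) v = B u (s i v)"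
  by (metis B_s s_s)

text \<open>In the group algebra this becomes the sum of the transpositions of \<open>i\<close> and
  \<open>m\<close> over \<open>i < m\<close>, with points counted from 0: conjugation by
  \<open>s m\<close> replaces \<open>m\<close> by \<open>Suc m\<close> in the old terms.\<close>

fun J :: "nat \<Rightarrow> 'v \<Rightarrow> 'v" where
  "J 0 v = 0"
| "J (Suc m) v = s m (J m (s m v)) + s m v"

lemma J_add: "J m (u + v) = J m u + J m v"
  by (induction m arbitrary: u v) (simp_all add: s_add)

lemma J_scale: "J m (c *s v) = c *s J m v"
  by (induction m arbitrary: v) (simp_all add: s_scale scale_right_distrib)

lemma J_minus: "J m (- v) = - J m v"
  using J_scale[of m "-1" v] by simp

lemma J_diff: "J m (u - v) = J m u - J m v"
  using J_add[of m u "- v"] by (simp add: J_minus)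

lemma J_zero [simp]: "J m 0 = 0"
  using J_diff[of m 0 0] by simp

lemma B_J: "B (J m u) v = B u (J m v)"
  by (induction m arbitrary: u v)
    (use B_scale[of 0] B_scale_right[of _ 0] in \<open>simp_all add: B_add B_add_right B_s_left\<close>)

lemma s_J_far: "m < j \<Longrightarrow> s j (J m v) = J m (s j v)"
  by (induction m arbitrary: v) (simp_all add: s_add s_comm[symmetric])

text \<open>\<open>J m\<close> is symmetric in the points below \<open>m\<close>, and
  \<open>s j\<close> exchanges two of these.\<close>

lemma s_J_below: "Suc j < m \<Longrightarrow> s j (J m v) = J m (s j v)"
proof (induction m arbitrary: v)
  case (Suc m)
  show ?case
  proof (cases "Suc j = m")
    case True
    \<comment> \<open>Only in this case do \<open>s j\<close> and \<open>s m\<close> fail to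
      commute. The braid relation carries \<open>s j\<close> through the conjugate of
      \<open>J j\<close> and interchanges the contributions of the two remaining summands.\<close>
    define i where "i = Suc j"
    have "s j (s i (s j (J j (s j (s i v))))) = s i (s j (s i (J j (s j (s i v)))))"
      by (simp add: i_def braid)
    also have "\<dots> = s i (s j (J j (s i (s j (s i v)))))"
      by (simp add: i_def s_J_far)
    also have "\<dots> = s i (s j (J j (s j (s i (s j v)))))"
      by (simp add: i_def braid)
    finally show ?thesis
      using True by (auto simp: s_add i_def braid J_add s_s add.commute)
  next
    case False
    with Suc.prems have "Suc j < m" by simp
    with Suc.IH show ?thesis by (simp add: s_add s_comm[of j m])
  qed
qed simp

text \<open>For \<open>k < m\<close>, \<open>J k\<close> is built from operators \<open>s j\<close>
  with \<open>Suc j < m\<close>, all of which commute with \<open>J m\<close>.\<close>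

lemma J_comm: "J k (J m v) = J m (J k v)"
proof -
  have *: "k < m \<Longrightarrow> J k (J m v) = J m (J k v)" for k m v
    by (induction k arbitrary: v) (simp_all add: J_add s_J_below)
  show ?thesis
    using *[of k m v] *[of m k v] by (cases k m rule: linorder_cases) auto
qed

text \<open>This and the next lemma are the exchange relations of the degenerate affine Hecke
  algebra.\<close>

lemma J_Suc_s: "J (Suc i) (s i v) = s i (J i v) + v"
  by (simp add: s_s)

lemma J_s: "J i (s i v) = s i (J (Suc i) v) - v"
  by (simp add: s_add s_s)

section \<open>Joint eigenvectors and the combinatorics of their content sequences\<close>

definition joint :: "nat \<Rightarrow> (nat \<Rightarrow> int) \<Rightarrow> 'v set" where
  "joint n a = {v. \<forall>m<n. J m v = of_int (a m) *s v}"

lemma subspace_joint: "subspace (joint n a)"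
  unfolding joint_def
  by (rule subspaceI) (auto simp: J_add J_scale scale_right_distrib mult.commute)

text \<open>Evaluate \<open>B (J i (s i v)) v\<close> twice: by the exchange relation and by
  self-adjointness of \<open>J i\<close>.\<close>

lemma joint_swap_relation:
  assumes "v \<in> joint n a" "Suc i < n"
  shows "of_int (a (Suc i) - a i) * B (s i v) v = B v v"
proof -
  have "J i (s i v) = of_int (a (Suc i)) *s s i v - v" and "J i v = of_int (a i) *s v"
    using assms J_s[of i v] by (auto simp: joint_def s_scale simp del: J.simps)
  with B_J[of i "s i v" v] show ?thesis
    by (simp add: B_diff B_scale B_scale_right algebra_simps)
qed

lemma joint_neighbours_distinct:
  assumes "v \<in> joint n a" "v \<noteq> 0" "Suc i < n"
  shows "a (Suc i) \<noteq> a i"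
  using joint_swap_relation[OF assms(1,3)] assms(2) B_pos by auto

text \<open>The form vanishes on \<open>s i v - of_int \<delta> *s v\<close>: as \<delta> is a sign
  and \<open>s i\<close> an isometry, its value there is
  \<open>2 * B v v - 2 * of_int \<delta> * B (s i v) v\<close>, which is 0 by the swap
  relation.\<close>

lemma joint_neighbours_adjacent:
  assumes "v \<in> joint n a" "Suc i < n" "a (Suc i) - a i = \<delta>" "\<delta> = 1 \<or> \<delta> = -1"
  shows "s i v = of_int \<delta> *s v"
proof -
  have "of_int \<delta> * B (s i v) v = B v v"
    using joint_swap_relation[OF assms(1,2)] assms(3) by simp
  then have "B (s i v - of_int \<delta> *s v) (s i v - of_int \<delta> *s v) = 0"
    using assms(4) B_s[of i v v]
    by (auto simp: B_diff B_diff_right B_scale B_scale_right B_minus B_sym[of v "s i v"])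
  then show ?thesis using B_pos by force
qed

definition contents :: "nat \<Rightarrow> (nat \<Rightarrow> int) set" where
  "contents n = {a. \<exists>v\<in>joint n a. v \<noteq> 0}"

lemma contents_0: "a \<in> contents n \<Longrightarrow> 0 < n \<Longrightarrow> a 0 = 0"
  by (auto simp: contents_def joint_def dest!: spec[of _ 0])

lemma contents_distinct: "a \<in> contents n \<Longrightarrow> Suc i < n \<Longrightarrow> a (Suc i) \<noteq> a i"
  using joint_neighbours_distinct unfolding contents_def by blast

lemma contents_swap:
  assumes "a \<in> contents n" "Suc i < n" "\<bar>a (Suc i) - a i\<bar> \<noteq> 1"
  shows "a \<circ> transpose i (Suc i) \<in> contents n"
proof -
  obtain v where v: "v \<in> joint n a" "v \<noteq> 0"
    using assms by (auto simp: contents_def)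
  define \<delta> :: rat where "\<delta> = of_int (a (Suc i) - a i)"
  \<comment> \<open>As in Young's seminormal form, correcting \<open>s i v\<close> by a multiple of
    \<open>v\<close> gives an eigenvector with the two contents exchanged.\<close>
  define u where "u = s i v - inverse \<delta> *s v"
  have \<delta>0: "\<delta> \<noteq> 0"
    using contents_distinct[OF assms(1,2)] by (simp add: \<delta>_def)
  have "u \<noteq> 0"
  proof
    assume "u = 0"
    then have "s i v = inverse \<delta> *s v" by (simp add: u_def)
    with B_s[of i v v] have "inverse \<delta> * inverse \<delta> * B v v = B v v"
      by (simp add: B_scale B_scale_right)
    with v B_pos have "inverse \<delta> * inverse \<delta> = 1" by auto
    with \<delta>0 have "\<delta> * \<delta> = 1" by (simp add: field_simps)
    then have "(a (Suc i) - a i) * (a (Suc i) - a i) = 1"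
      unfolding \<delta>_def by (metis of_int_eq_1_iff of_int_mult)
    then have "\<bar>a (Suc i) - a i\<bar> = 1"
      using abs_zmult_eq_1[of "a (Suc i) - a i" "a (Suc i) - a i"] by auto
    with assms show False by simp
  qed
  moreover have "u \<in> joint n (a \<circ> transpose i (Suc i))"
    unfolding joint_def
  proof safe
    fix m assume "m < n"
    then have Jm: "J m v = of_int (a m) *s v" using v by (simp add: joint_def)
    have Ji: "J i v = of_int (a i) *s v" "J (Suc i) v = of_int (a (Suc i)) *s v"
      using v assms by (auto simp: joint_def)
    \<comment> \<open>This identity absorbs the extra term \<open>v\<close> of the exchange
      relations.\<close>
    have \<delta>: "inverse \<delta> * of_int (a (Suc i)) = inverse \<delta> * of_int (a i) + 1"
      using \<delta>0 by (simp add: \<delta>_def field_simps)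
    consider "m = i" | "m = Suc i" | "m < i" | "Suc i < m" by linarith
    then show "J m u = of_int ((a \<circ> transpose i (Suc i)) m) *s u"
    proof cases
      case 1
      have "J i u = of_int (a (Suc i)) *s s i v - (inverse \<delta> * of_int (a i) + 1) *s v"
        using Ji unfolding u_def J_diff J_scale J_s by (simp add: s_scale scale_left_distrib)
      with 1 \<delta> show ?thesis
        by (simp add: u_def scale_right_diff_distrib mult.commute)
    next
      case 2
      have "J (Suc i) u = of_int (a i) *s s i v - (inverse \<delta> * of_int (a (Suc i)) - 1) *s v"
        using Ji unfolding u_def J_diff J_scale J_Suc_s by (simp add: s_scale scale_left_diff_distrib)
      with 2 \<delta> show ?thesis
        by (simp add: u_def scale_right_diff_distrib mult.commute)
    next
      case 3
      then show ?thesis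
        by (simp add: u_def J_diff J_scale s_J_far[symmetric] Jm s_scale
            scale_right_diff_distrib mult.commute)
    next
      case 4
      then show ?thesis
        by (simp add: u_def J_diff J_scale s_J_below[symmetric] Jm s_scale
            scale_right_diff_distrib mult.commute)
    qed
  qed
  ultimately show ?thesis by (auto simp: contents_def)
qed

text \<open>On the eigenvector, \<open>s i\<close> acts by \<epsilon> and \<open>s (Suc i)\<close>
  by -\<epsilon>, so the two sides of the braid relation act by opposite signs.\<close>

lemma contents_no_sandwich:
  assumes "a \<in> contents n" "Suc (Suc i) < n" "\<epsilon> = 1 \<or> \<epsilon> = -1"
    and "a (Suc i) = a i + \<epsilon>" "a (Suc (Suc i)) = a i"
  shows False
proof -
  obtain v where v: "v \<in> joint n a" "v \<noteq> 0"
    using assms by (auto simp: contents_def)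
  have 1: "s i v = of_int \<epsilon> *s v"
    by (rule joint_neighbours_adjacent[OF v(1)]) (use assms in auto)
  have 2: "s (Suc i) v = of_int (- \<epsilon>) *s v"
    by (rule joint_neighbours_adjacent[OF v(1)]) (use assms in auto)
  have "- \<epsilon> = \<epsilon>"
    using braid[of i v] v assms(3) by (auto simp: 1 2 s_scale s_minus simp flip: of_int_minus)
  with assms(3) show False by auto
qed

text \<open>\<open>J 1\<close> equals the involution \<open>s 0\<close>.\<close>

lemma contents_1:
  assumes "a \<in> contents n" "1 < n"
  shows "\<bar>a 1\<bar> = 1"
proof -
  obtain v where v: "v \<in> joint n a" "v \<noteq> 0"
    using assms by (auto simp: contents_def)
  then have "s 0 v = of_int (a 1) *s v"
    using assms by (auto simp: joint_def dest!: spec[of _ 1])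
  then have "v = of_int (a 1 * a 1) *s v"
    using s_s[of 0 v] by (simp add: s_scale)
  then have "(1 - of_int (a 1 * a 1)) *s v = 0"
    by (simp only: scale_left_diff_distrib) simp
  with v have "of_int (a 1 * a 1) = (1::rat)" by simp
  then have "a 1 * a 1 = 1" by (simp only: of_int_eq_1_iff)
  then show ?thesis using abs_zmult_eq_1[of "a 1" "a 1"] by auto
qed

text \<open>Induction on the distance of two consecutive occurrences of a value. If an end is not
  adjacent in value to its inner neighbour, a swap brings the ends closer. Otherwise, unless the
  desired value is present, both inner neighbours are \<open>a p + \<epsilon>\<close>. If they
  coincide, they form a forbidden sandwich; if not, the induction hypothesis between two occurrences
  of \<open>a p + \<epsilon>\<close> produces a further \<open>a p\<close>.\<close>

lemma contents_between:
  assumes "a \<in> contents n" "p < q" "q < n" "a q = a p" "\<forall>r. p < r \<and> r < q \<longrightarrow> a r \<noteq> a p"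
    and "\<epsilon> = 1 \<or> \<epsilon> = -1"
  shows "\<exists>r. p < r \<and> r < q \<and> a r = a p - \<epsilon>"
  using assms
proof (induction "q - p" arbitrary: a p q \<epsilon> rule: less_induct)
  case less
  show ?case
  proof (rule ccontr)
    assume none: "\<not> ?case"
    have pq: "Suc p < q"
      using contents_distinct[OF less.prems(1), of p] less.prems
      by (metis Suc_lessI)
    then obtain q' where q': "q = Suc q'" "p < q'" by (cases q) auto
    have close: "\<bar>a q - a q'\<bar> = 1"
    proof (rule ccontr)
      assume *: "\<bar>a q - a q'\<bar> \<noteq> 1"
      define a' where "a' = a \<circ> transpose q' (Suc q')"
      have a': "a' \<in> contents n"
        unfolding a'_def using contents_swap less.prems q' * by metis
      have [simp]: "a' r = a r" if "r < q'" for r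
        using that by (simp add: a'_def transpose_def)
      have [simp]: "a' q' = a q" using q' by (simp add: a'_def)
      have "\<exists>r. p < r \<and> r < q' \<and> a' r = a' p - \<epsilon>"
        by (rule less.hyps[OF _ a']) (use q' less.prems in auto)
      with none q' show False by auto
    qed
    have close2: "\<bar>a (Suc p) - a p\<bar> = 1"
    proof (rule ccontr)
      assume *: "\<bar>a (Suc p) - a p\<bar> \<noteq> 1"
      define a' where "a' = a \<circ> transpose p (Suc p)"
      have a': "a' \<in> contents n"
        unfolding a'_def using contents_swap less.prems q' * by simp
      have [simp]: "a' r = a r" if "r > Suc p" for r
        using that by (simp add: a'_def transpose_def)
      have [simp]: "a' (Suc p) = a p" by (simp add: a'_def)
      have "\<exists>r. Suc p < r \<and> r < q \<and> a' r = a' (Suc p) - \<epsilon>"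
        by (rule less.hyps[OF _ a']) (use q' less.prems in auto)
      then obtain r where "Suc p < r" "r < q" "a r = a p - \<epsilon>" by auto
      with none show False by (meson Suc_lessD)
    qed
    have "a q' \<noteq> a p - \<epsilon>" "a (Suc p) \<noteq> a p - \<epsilon>"
      using none q' pq by (metis lessI, metis lessI)
    with close close2 less.prems have e: "a q' = a p + \<epsilon>" "a (Suc p) = a p + \<epsilon>"
      by auto
    show False
    proof (cases "q' = Suc p")
      case True
      with contents_no_sandwich[OF less.prems(1), of p \<epsilon>] e q' less.prems show False by auto
    next
      case False
      \<comment> \<open>The first recurrence of \<open>a p + \<epsilon>\<close> is taken because the
        induction hypothesis speaks about consecutive occurrences.\<close>
      define r where "r = (LEAST r. Suc p < r \<and> a r = a p + \<epsilon>)"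
      have "Suc p < q' \<and> a q' = a p + \<epsilon>" using False q' e by auto
      then have r: "Suc p < r \<and> a r = a p + \<epsilon>" "r \<le> q'"
        and least: "Suc p < r' \<Longrightarrow> r' < r \<Longrightarrow> a r' \<noteq> a p + \<epsilon>" for r'
        unfolding r_def by (rule LeastI, rule Least_le, use not_less_Least in blast)
      have "\<exists>t. Suc p < t \<and> t < r \<and> a t = a (Suc p) - \<epsilon>"
        by (rule less.hyps[OF _ less.prems(1)]) (use r q' e least less.prems in auto)
      then obtain t where "Suc p < t" "t < r" "a t = a p" using e by auto
      with less.prems(5) r q' show False by auto
    qed
  qed
qed

text \<open>As long as the entry is not adjacent in value to its left neighbour, it can be swapped
  leftwards; at position 1 the values 0 and 1 or -1 settle the claim.\<close>

lemma contents_neighbour_before: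
  assumes "a \<in> contents n" "0 < q" "q < n"
  shows "\<exists>r<q. \<bar>a q - a r\<bar> \<le> 1"
  using assms
proof (induction q arbitrary: a)
  case (Suc q)
  show ?case
  proof (cases "q = 0")
    case True
    with contents_0[OF Suc.prems(1)] contents_1[OF Suc.prems(1)] Suc.prems
    show ?thesis by (intro exI[of _ 0]) auto
  next
    case False
    show ?thesis
    proof (cases "\<bar>a (Suc q) - a q\<bar> = 1")
      case True
      then show ?thesis by (intro exI[of _ q]) auto
    next
      case far: False
      define a' where "a' = a \<circ> transpose q (Suc q)"
      have a': "a' \<in> contents n"
        unfolding a'_def using contents_swap Suc.prems far by metis
      have "\<exists>r<q. \<bar>a' q - a' r\<bar> \<le> 1"
        using Suc.IH[OF a'] False Suc.prems by simp
      then obtain r where "r < q" "\<bar>a' q - a' r\<bar> \<le> 1" by blast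
      then have "r < Suc q \<and> \<bar>a (Suc q) - a r\<bar> \<le> 1"
        by (simp add: a'_def transpose_def split: if_splits)
      then show ?thesis by blast
    qed
  qed
qed simp

text \<open>Some earlier value differs from \<open>a q\<close> by at most 1. If it is equal, recurse
  on its position; if it lies one step further from 0, recurse twice, first down to
  \<open>a q\<close> and then to the value sought.\<close>

lemma contents_predecessor:
  assumes "a \<in> contents n" "q < n" "\<epsilon> = 1 \<or> \<epsilon> = -1" "\<epsilon> * a q \<ge> 1"
  shows "\<exists>r<q. a r = a q - \<epsilon>"
  using assms(2,4)
proof (induction q rule: less_induct)
  case (less q)
  have "q \<noteq> 0" using less.prems contents_0[OF assms(1)] by (intro notI) auto
  with contents_neighbour_before[OF assms(1)] less.prems obtain r
    where r: "r < q" "\<bar>a q - a r\<bar> \<le> 1" by blast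
  then consider "a r = a q - \<epsilon>" | "a r = a q" | "a r = a q + \<epsilon>"
    using assms(3) by fastforce
  then show ?case
  proof cases
    case 1
    with r show ?thesis by blast
  next
    case 2
    with less.IH[of r] less.prems r show ?thesis by (metis order.strict_trans)
  next
    case 3
    have *: "\<epsilon> * a r \<ge> 1" using 3 assms(3) less.prems by auto
    with less.IH[of r] less.prems r obtain t where t: "t < r" "a t = a q"
      using 3 by force
    with less.IH[of t] less.prems r show ?thesis by (metis order.strict_trans)
  qed
qed

text \<open>If the value \<open>a q\<close> occurred before, look behind its last previous
  occurrence. The condition on the gap makes the choice of \<open>r\<close> injective in the count
  that follows.\<close>

lemma contents_last_predecessor:
  assumes "a \<in> contents n" "q < n" "\<epsilon> = 1 \<or> \<epsilon> = -1" "\<epsilon> * a q \<ge> 1"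
  shows "\<exists>r<q. a r = a q - \<epsilon> \<and> (\<forall>p. r < p \<and> p < q \<longrightarrow> a p \<noteq> a q)"
proof (cases "\<exists>p<q. a p = a q")
  case True
  define p where "p = Max {p. p < q \<and> a p = a q}"
  have "p \<in> {p. p < q \<and> a p = a q}"
    unfolding p_def using True by (intro Max_in) auto
  then have p: "p < q" "a p = a q" by auto
  have mx: "r \<le> p" if "r < q" "a r = a q" for r
    unfolding p_def using that by (intro Max_ge) auto
  have "\<exists>r. p < r \<and> r < q \<and> a r = a p - \<epsilon>"
    by (rule contents_between[OF assms(1) p(1) assms(2)]) (use p mx assms in fastforce)+
  then show ?thesis using p mx by (metis less_le_not_le order.strict_trans)
next
  case False
  with contents_predecessor[OF assms] show ?thesis by blast
qed

text \<open>Map each occurrence of \<open>k\<close> to its last predecessor. For occurrences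
  \<open>p < q\<close> this gives \<open>f p < p\<close> and \<open>p \<le> f q\<close>, hence an
  injection.\<close>

lemma contents_card_mono:
  assumes "a \<in> contents n" "\<epsilon> = 1 \<or> \<epsilon> = -1" "\<epsilon> * k \<ge> 1"
  shows "card {q. q < n \<and> a q = k} \<le> card {q. q < n \<and> a q = k - \<epsilon>}"
proof -
  define f where "f q = (SOME r. r < q \<and> a r = a q - \<epsilon> \<and> (\<forall>p. r < p \<and> p < q \<longrightarrow> a p \<noteq> a q))" for q
  have f: "f q < q" "a (f q) = k - \<epsilon>" "\<forall>p. f q < p \<and> p < q \<longrightarrow> a p \<noteq> k"
    if "q < n" "a q = k" for q
    using someI_ex[OF contents_last_predecessor[OF assms(1) that(1) assms(2)]] that assms(3)
    unfolding f_def by auto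
  have "inj_on f {q. q < n \<and> a q = k}"
  proof (rule linorder_inj_onI)
    fix p q assume "p < q" "p \<in> {q. q < n \<and> a q = k}" "q \<in> {q. q < n \<and> a q = k}"
    then have "f p < p" "p < q" "a p = k" and "\<forall>r. f q < r \<and> r < q \<longrightarrow> a r \<noteq> k"
      using f[of p] f[of q] by simp_all
    then show "f p \<noteq> f q" by metis
  qed auto
  moreover have "f ` {q. q < n \<and> a q = k} \<subseteq> {q. q < n \<and> a q = k - \<epsilon>}"
    using f by (auto intro: order.strict_trans)
  ultimately show ?thesis by (intro card_inj_on_le) auto
qed

text \<open>The multiplicities of the values from \<epsilon> to \<open>k\<close> are all at least
  that of \<open>k\<close>, and their positions are disjoint. Strictness comes from position 0,
  whose content is 0.\<close>

lemma contents_card_bound: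
  assumes "a \<in> contents n" "k \<noteq> 0" "0 < n"
  shows "nat \<bar>k\<bar> * card {q. q < n \<and> a q = k} < n"
proof -
  define \<epsilon> where "\<epsilon> = sgn k"
  define N where "N j = card {q. q < n \<and> a q = \<epsilon> * int j}" for j :: nat
  have \<epsilon>: "\<epsilon> = 1 \<or> \<epsilon> = -1" using assms(2) by (auto simp: \<epsilon>_def sgn_if)
  have k: "k = \<epsilon> * int (nat \<bar>k\<bar>)" by (simp add: \<epsilon>_def sgn_if)
  have step: "N (Suc j) \<le> N j" for j
    using contents_card_mono[OF assms(1) \<epsilon>, of "\<epsilon> * int (Suc j)"] \<epsilon>
    by (auto simp: N_def algebra_simps)
  have mono: "N (nat \<bar>k\<bar>) \<le> N j" if "j \<le> nat \<bar>k\<bar>" for j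
    using lift_Suc_antimono_le[of N, OF step that] .
  have "nat \<bar>k\<bar> * N (nat \<bar>k\<bar>) \<le> (\<Sum>j=1..nat \<bar>k\<bar>. N j)"
    using sum_mono[of "{1..nat \<bar>k\<bar>}" "\<lambda>_. N (nat \<bar>k\<bar>)" N] mono by simp
  also have "\<dots> = card (\<Union>j\<in>{1..nat \<bar>k\<bar>}. {q. q < n \<and> a q = \<epsilon> * int j})"
    unfolding N_def using \<epsilon> by (intro card_UN_disjoint[symmetric]) auto
  also have "\<dots> \<le> card {1..<n}"
  proof (intro card_mono)
    show "(\<Union>j\<in>{1..nat \<bar>k\<bar>}. {q. q < n \<and> a q = \<epsilon> * int j}) \<subseteq> {1..<n}"
    proof safe
      fix j q assume "j \<in> {1..nat \<bar>k\<bar>}" "q < n" "a q = \<epsilon> * int j"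
      then have "q \<noteq> 0" using contents_0[OF assms(1,3)] \<epsilon> by (intro notI) auto
      then show "q \<in> {1..<n}" using \<open>q < n\<close> by simp
    qed
  qed simp
  also have "\<dots> < n" using assms(3) by simp
  finally show ?thesis using k by (simp add: N_def)
qed

section \<open>Integral eigenvalues and simultaneous diagonalization\<close>

definition shifts :: "nat \<Rightarrow> int list \<Rightarrow> 'v \<Rightarrow> 'v" where
  "shifts m ks v = foldr (\<lambda>k w. J m w - of_int k *s w) ks v"

lemma shifts_simps [simp]:
  "shifts m [] v = v"
  "shifts m (k # ks) v = J m (shifts m ks v) - of_int k *s shifts m ks v"
  by (simp_all add: shifts_def)

lemma shifts_append: "shifts m (ks @ ls) v = shifts m ks (shifts m ls v)"
  by (simp add: shifts_def)

lemma shifts_add: "shifts m ks (u + v) = shifts m ks u + shifts m ks v"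
  by (induction ks) (simp_all add: J_add scale_right_distrib)

lemma shifts_scale: "shifts m ks (c *s v) = c *s shifts m ks v"
  by (induction ks) (simp_all add: J_scale scale_right_diff_distrib mult.commute)

lemma shifts_zero [simp]: "shifts m ks 0 = 0"
  by (induction ks) simp_all

lemma shifts_J: "shifts m ks (J m v) = J m (shifts m ks v)"
  by (induction ks) (simp_all add: J_diff J_scale)

lemma shifts_comm: "shifts m ks (shifts m ls v) = shifts m ls (shifts m ks v)"
  by (induction ls)
    (simp_all add: shifts_J shifts_scale shifts_add[of _ _ _ "- _", simplified]
      diff_conv_add_uminus shifts_add scale_minus_left[symmetric] del: scale_minus_left)

definition eigen :: "nat \<Rightarrow> 'v set" where
  "eigen m = {w. \<exists>k :: int. J m w = of_int k *s w}"

text \<open>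
  Integrality of the eigenvalues is the hypothesis; self-adjointness excludes Jordan blocks, so no
  distinctness of \<open>ks\<close> is needed.
\<close>

lemma eigen_generates:
  assumes W: "subspace W" "\<And>w. w \<in> W \<Longrightarrow> J m w \<in> W"
    and "v \<in> W" "shifts m ks v = 0"
  shows "v \<in> span (eigen m \<inter> W)"
  using assms(3,4)
proof (induction ks arbitrary: v rule: rev_induct)
  case Nil
  then show ?case by (simp add: span_zero)
next
  case (snoc k ks)
  let ?E = "span (eigen m \<inter> W)"
  let ?D = "\<lambda>y. J m y - of_int k *s y"
  \<comment> \<open>Image plus kernel of \<open>?D\<close>: an eigenvector with eigenvalue
    \<open>k\<close> lies in the kernel, any other one in the image, since \<open>?D\<close> scales
    it by a nonzero number.\<close>
  let ?Z = "{?D y + z | y z. y \<in> ?E \<and> z \<in> W \<and> ?D z = 0}"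
  have "subspace ?Z"
  proof (rule subspaceI)
    show "0 \<in> ?Z"
      by (auto intro!: exI[of _ 0] simp: span_zero subspace_0[OF W(1)])
  next
    fix x y assume "x \<in> ?Z" "y \<in> ?Z"
    then obtain y1 z1 y2 z2 where 1: "x = ?D y1 + z1" "y1 \<in> ?E" "z1 \<in> W" "?D z1 = 0"
      and 2: "y = ?D y2 + z2" "y2 \<in> ?E" "z2 \<in> W" "?D z2 = 0" by blast
    show "x + y \<in> ?Z"
      by (rule CollectI, rule exI[of _ "y1 + y2"], rule exI[of _ "z1 + z2"])
        (use 1 2 W(1) in \<open>auto simp: J_add scale_right_distrib span_add subspace_add\<close>)
  next
    fix c x assume "x \<in> ?Z"
    then obtain y1 z1 where 1: "x = ?D y1 + z1" "y1 \<in> ?E" "z1 \<in> W" "?D z1 = 0" by blast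
    show "c *s x \<in> ?Z"
      by (rule CollectI, rule exI[of _ "c *s y1"], rule exI[of _ "c *s z1"])
        (use 1 W(1) in \<open>auto simp: J_scale scale_right_distrib scale_right_diff_distrib
          span_scale subspace_scale mult.commute\<close>)
  qed
  moreover have "eigen m \<inter> W \<subseteq> ?Z"
  proof
    fix u assume u: "u \<in> eigen m \<inter> W"
    then obtain l :: int where l: "J m u = of_int l *s u" by (auto simp: eigen_def)
    show "u \<in> ?Z"
    proof (cases "l = k")
      case True
      with l u show ?thesis by (intro CollectI exI[of _ 0] exI[of _ u]) (auto simp: span_zero)
    next
      case False
      define c :: rat where "c = inverse (of_int (l - k))"
      have "?D (c *s u) = (c * of_int (l - k)) *s u"
        by (simp add: J_scale l scale_left_diff_distrib algebra_simps)
      then have "?D (c *s u) = u" using False by (simp add: c_def)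
      with u W(1) show ?thesis
        by (intro CollectI exI[of _ "c *s u"] exI[of _ 0])
          (auto simp: span_base span_scale subspace_0)
    qed
  qed
  ultimately have E: "?E \<subseteq> ?Z" by (rule span_minimal[rotated])
  have "?D v \<in> ?E"
    by (rule snoc.IH)
      (use snoc.prems W in \<open>auto simp: shifts_append subspace_diff subspace_scale\<close>)
  with E obtain y z where yz: "?D v = ?D y + z" "y \<in> ?E" "z \<in> W" "?D z = 0" by blast
  define x where "x = v - y"
  have x: "?D x = z"
    using yz by (simp add: x_def J_diff scale_right_diff_distrib algebra_simps)
  \<comment> \<open>\<open>?D x = z\<close> is killed by \<open>?D\<close>; since \<open>?D\<close>
    is self-adjoint, the form vanishes on \<open>?D x\<close>, so \<open>x\<close> itself is an
    eigenvector.\<close>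
  have "B (?D x) (?D x) = B x (?D (?D x))"
    by (simp add: B_diff B_diff_right B_scale B_scale_right B_J J_diff J_scale)
  also have "?D (?D x) = 0"
    unfolding x by (fact yz(4))
  also have "B x 0 = 0"
    using B_scale_right[of x 0 0] by simp
  finally have "?D x = 0" by (rule B_pos)
  moreover have "y \<in> W"
    using yz(2) span_minimal[of "eigen m \<inter> W" W] W(1) by auto
  ultimately have "x \<in> eigen m \<inter> W"
    using snoc.prems W(1) by (auto simp: eigen_def x_def subspace_diff)
  then have "x + y \<in> ?E" using yz(2) by (rule span_add[OF span_base])
  then show ?case by (simp add: x_def)
qed

text \<open>
  Besides intertwining \<open>J m\<close> with \<open>J (Suc m)\<close>, this operator squares to \<open>1 - (J (Suc m) - J m)\<^sup>2\<close>:
  a product of integral shifts that annihilates \<open>J m\<close> thus yields one for \<open>J (Suc m)\<close>.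
\<close>

definition intertwiner :: "nat \<Rightarrow> 'v \<Rightarrow> 'v" where
  "intertwiner m v = J (Suc m) (s m v) - J m (s m v) - v"

lemma J_intertwiner: "J (Suc m) (intertwiner m v) = intertwiner m (J m v)"
proof -
  have "s m (J (Suc m) v) = J m (s m v) + v" by (simp add: s_add s_s)
  then show ?thesis
    unfolding intertwiner_def
    using J_Suc_s[of m v] J_Suc_s[of m "J m v"]
    by (simp add: J_diff J_add J_comm[of "Suc m" m] del: J.simps)
qed

lemma shifts_intertwiner: "shifts (Suc m) ks (intertwiner m v) = intertwiner m (shifts m ks v)"
proof (induction ks)
  case (Cons k ks)
  have lin: "intertwiner m (x - c *s y) = intertwiner m x - c *s intertwiner m y" for x y c
    by (simp add: intertwiner_def J_diff J_scale s_diff s_scale scale_right_diff_distrib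
        del: J.simps)
  show ?case
    by (simp add: Cons.IH J_intertwiner lin del: J.simps)
qed simp

lemma intertwiner_square:
  "intertwiner m (intertwiner m v) =
    v + J m (J (Suc m) v) + J m (J (Suc m) v) - J (Suc m) (J (Suc m) v) - J m (J m v)"
proof -
  have s1: "s m (J (Suc m) w) = J m (s m w) + w" and s2: "s m (J m w) = J (Suc m) (s m w) - w" for w
    by (simp_all add: s_add s_s)
  have "s m (intertwiner m v) = J m v - J (Suc m) v + s m v"
    by (simp add: intertwiner_def s_diff s1 s2 s_s del: J.simps)
  then show ?thesis
    by (simp add: intertwiner_def[of m "intertwiner m v"] J_diff J_add J_comm[of "Suc m" m]
        del: J.simps)
      (simp add: intertwiner_def J_diff J_add del: J.simps)
qed

text \<open>With \<open>J m\<close> acting on \<open>v\<close> by \<open>k\<close>, the square of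
  the intertwiner becomes 1 minus the square of \<open>J (Suc m) - k\<close>, and this difference of
  squares splits into the two shifts.\<close>

lemma shifts_eigenvector:
  assumes "J m v = of_int k *s v"
  shows "shifts (Suc m) [k + 1, k - 1] v = - intertwiner m (intertwiner m v)"
proof -
  have "shifts (Suc m) [k + 1, k - 1] v =
      J (Suc m) (J (Suc m) v) - of_int (k - 1) *s J (Suc m) v - of_int (k + 1) *s J (Suc m) v
        + of_int (k * k - 1) *s v"
    by (simp add: J_diff J_add J_scale scale_right_diff_distrib algebra_simps del: J.simps)
  also have "\<dots> = J (Suc m) (J (Suc m) v) - of_int k *s J (Suc m) v - of_int k *s J (Suc m) v
        + of_int (k * k) *s v - v"
    by (simp add: scale_left_diff_distrib scale_left_distrib del: J.simps)
  also have "\<dots> = - intertwiner m (intertwiner m v)"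
    by (simp add: intertwiner_square J_comm[of m "Suc m"] assms J_scale del: J.simps)
  finally show ?thesis .
qed

lemma subspace_shifts_kernel: "subspace {v. \<exists>ks. shifts m ks v = 0}"
proof (rule subspaceI)
  fix u v assume "u \<in> {v. \<exists>ks. shifts m ks v = 0}" "v \<in> {v. \<exists>ks. shifts m ks v = 0}"
  then obtain ks ls where "shifts m ks u = 0" "shifts m ls v = 0" by auto
  then have "shifts m (ks @ ls) (u + v) = 0"
    by (simp add: shifts_append shifts_add shifts_comm[of m ks ls u])
  then show "u + v \<in> {v. \<exists>ks. shifts m ks v = 0}" by blast
qed (auto simp: shifts_scale intro: exI[of _ "[]"] dest: arg_cong[where f = "scale _"])

lemma shifts_annihilate: "\<exists>ks. shifts m ks v = 0"
proof (induction m arbitrary: v)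
  case 0
  show ?case by (intro exI[of _ "[0]"]) simp
next
  case (Suc m)
  have "v \<in> span (eigen m \<inter> UNIV)"
    using eigen_generates[of UNIV m v] Suc.IH[of v] subspace_UNIV by blast
  moreover have "eigen m \<inter> UNIV \<subseteq> {v. \<exists>ks. shifts (Suc m) ks v = 0}"
  proof safe
    fix w assume "w \<in> eigen m"
    then obtain k :: int where k: "J m w = of_int k *s w" by (auto simp: eigen_def)
    \<comment> \<open>The shifts are chosen for \<open>intertwiner m w\<close> rather than
      \<open>w\<close>: one of the two intertwiners is consumed inside, the other is carried past
      the shifts.\<close>
    obtain ks where ks: "shifts m ks (intertwiner m w) = 0" using Suc.IH by blast
    have "shifts (Suc m) (ks @ [k + 1, k - 1]) w = shifts (Suc m) ks (- intertwiner m (intertwiner m w))"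
      unfolding shifts_append shifts_eigenvector[OF k] ..
    also have "\<dots> = - intertwiner m (shifts m ks (intertwiner m w))"
      using shifts_scale[of "Suc m" ks "-1"] by (simp add: shifts_intertwiner)
    also have "\<dots> = 0" unfolding ks by (simp add: intertwiner_def del: J.simps)
    finally show "\<exists>ks. shifts (Suc m) ks w = 0" by blast
  qed
  ultimately show ?case
    using span_minimal[OF _ subspace_shifts_kernel] by blast
qed

text \<open>Each joint eigenspace of the first \<open>n\<close> operators is invariant under
  \<open>J n\<close> by commutativity, hence generated by eigenvectors of \<open>J n\<close> within
  it.\<close>

lemma joint_generates: "v \<in> span (\<Union>a. joint n a)"
proof (induction n arbitrary: v)
  case 0
  then show ?case by (intro span_base) (simp add: joint_def)
next
  case (Suc n)
  have "(\<Union>a. joint n a) \<subseteq> span (\<Union>a. joint (Suc n) a)"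
  proof safe
    fix a w assume w: "w \<in> joint n a"
    obtain ks where "shifts n ks w = 0" using shifts_annihilate by blast
    then have "w \<in> span (eigen n \<inter> joint n a)"
      by (intro eigen_generates[OF subspace_joint _ w])
        (auto simp: joint_def J_comm[of _ n] J_scale)
    moreover have "eigen n \<inter> joint n a \<subseteq> (\<Union>a. joint (Suc n) a)"
    proof
      fix u assume "u \<in> eigen n \<inter> joint n a"
      then obtain k :: int where "J n u = of_int k *s u" "u \<in> joint n a" by (auto simp: eigen_def)
      then have "u \<in> joint (Suc n) (a(n := k))" by (auto simp: joint_def less_Suc_eq)
      then show "u \<in> (\<Union>a. joint (Suc n) a)" by blast
    qed
    ultimately show "w \<in> span (\<Union>a. joint (Suc n) a)" using span_mono by blast
  qed
  then show ?case using Suc.IH[of v] span_minimal subspace_span by blast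
qed

text \<open>\<open>complete n b\<close> is the complete homogeneous polynomial \<open>h\<^sub>b(J 0, \<dots>, J (n - 1))\<close>.\<close>

fun complete :: "nat \<Rightarrow> nat \<Rightarrow> 'v \<Rightarrow> 'v" where
  "complete 0 b v = (if b = 0 then v else 0)"
| "complete (Suc n) 0 v = v"
| "complete (Suc n) (Suc b) v = complete n (Suc b) v + J n (complete (Suc n) b v)"

lemma complete_0 [simp]: "complete n 0 v = v"
  by (cases n) auto

lemma complete_add: "complete n b (u + v) = complete n b u + complete n b v"
  by (induction n b u rule: complete.induct) (auto simp: J_add)

lemma complete_scale: "complete n b (c *s v) = c *s complete n b v"
  by (induction n b v rule: complete.induct) (auto simp: J_scale scale_right_distrib)

end

section \<open>Generating functions with bounded poles\<close>

inductive_set fspan :: "rat fps set \<Rightarrow> rat fps set" for S where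
  fspan_zero: "0 \<in> fspan S"
| fspan_base: "f \<in> S \<Longrightarrow> f \<in> fspan S"
| fspan_add: "f \<in> fspan S \<Longrightarrow> g \<in> fspan S \<Longrightarrow> f + g \<in> fspan S"
| fspan_scale: "f \<in> fspan S \<Longrightarrow> fps_const c * f \<in> fspan S"

lemma fspan_diff: "f \<in> fspan S \<Longrightarrow> g \<in> fspan S \<Longrightarrow> f - g \<in> fspan S"
  using fspan_add[OF _ fspan_scale[of g S "-1"], of f] by (simp flip: fps_const_neg)

lemma fspan_sum: "(\<And>x. x \<in> A \<Longrightarrow> f x \<in> fspan S) \<Longrightarrow> sum f A \<in> fspan S"
  by (induction A rule: infinite_finite_induct) (auto intro: fspan_zero fspan_add)

lemma fspan_mono: "S \<subseteq> fspan T \<Longrightarrow> fspan S \<subseteq> fspan T"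
proof
  fix f assume "S \<subseteq> fspan T" "f \<in> fspan S"
  from this(2,1) show "f \<in> fspan T"
    by induction (auto intro: fspan.intros)
qed

lemma fspan_mult:
  assumes "\<And>f g. f \<in> S \<Longrightarrow> g \<in> T \<Longrightarrow> f * g \<in> fspan U"
    and "f \<in> fspan S" "g \<in> fspan T"
  shows "f * g \<in> fspan U"
  using assms(2)
proof induction
  case (fspan_base f)
  from assms(3) show ?case
  proof induction
    case (fspan_scale g c)
    then show ?case using fspan.fspan_scale[of "f * g" U c] by (simp add: mult_ac)
  qed (auto intro: fspan.intros assms(1) fspan_base simp: distrib_left)
qed (auto intro: fspan.intros simp: distrib_right mult.assoc)

section \<open>Geometric series, partial fractions and coefficients\<close>

unbundle fps_syntax

definition geo :: "int \<Rightarrow> rat fps" where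
  "geo k = inverse (1 - fps_const (of_int k) * fps_X)"

lemma geo_mult: "geo k * (1 - fps_const (of_int k) * fps_X) = 1"
  unfolding geo_def by (rule inverse_mult_eq_1) simp

lemma geo_0 [simp]: "geo 0 = 1"
  by (simp add: geo_def)

text \<open>Compare coefficients in \<open>h = f + k X h\<close>, where
  \<open>h = f * geo k\<close>. The resulting recursion has the shape of that of
  \<open>complete\<close>.\<close>

lemma geo_mult_nth:
  "(f * geo k) $ 0 = f $ 0"
  "(f * geo k) $ Suc b = f $ Suc b + of_int k * (f * geo k) $ b"
proof -
  have *: "h = f + fps_const (of_int k) * (fps_X * h)"
    if "h * (1 - fps_const (of_int k) * fps_X) = f" for h
    unfolding that[symmetric] by (simp add: algebra_simps)
  have "f * geo k = f + fps_const (of_int k) * (fps_X * (f * geo k))"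
    using geo_mult[of k] by (intro *) (simp add: mult.assoc)
  then have "(f * geo k) $ b = (f + fps_const (of_int k) * (fps_X * (f * geo k))) $ b" for b
    by (rule arg_cong)
  from this[of 0] this[of "Suc b"] show "(f * geo k) $ 0 = f $ 0"
    "(f * geo k) $ Suc b = f $ Suc b + of_int k * (f * geo k) $ b"
    by (simp_all del: fps_mult_nth_0)
qed

text \<open>Multiply \<open>k (1 - l X) - l (1 - k X) = k - l\<close> by both geometric series and
  divide by \<open>k - l\<close>.\<close>

lemma geo_partial_fractions:
  assumes "k \<noteq> l"
  shows "geo k * geo l = fps_const (of_int k / of_int (k - l)) * geo k
    - fps_const (of_int l / of_int (k - l)) * geo l" (is "_ = ?r")
proof -
  define X where "X = (fps_X :: rat fps)"
  define K L D where "K = fps_const (of_int k :: rat)" "L = fps_const (of_int l :: rat)"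
    "D = fps_const (inverse (of_int (k - l)) :: rat)"
  have D: "D * (K - L) = 1"
    using assms unfolding K_L_D_def fps_const_sub fps_const_mult by simp
  have k: "geo k * (1 - K * X) = 1" and l: "geo l * (1 - L * X) = 1"
    using geo_mult unfolding X_def K_L_D_def by auto
  have r: "?r = D * K * geo k - D * L * geo l"
    by (simp add: K_L_D_def divide_inverse mult.commute)
  have "geo k * geo l = D * (K - L) * (geo k * geo l)"
    by (simp add: D)
  also have "\<dots> = D * K * geo k * (geo l * (1 - L * X)) - D * L * geo l * (geo k * (1 - K * X))"
    by (simp add: algebra_simps)
  also have "\<dots> = ?r" unfolding r by (simp add: k l)
  finally show ?thesis .
qed

text \<open>One partial fraction step trades \<open>geo k ^ Suc i * geo l\<close> for a pure power
  of \<open>geo k\<close> and the same product with exponent \<open>i\<close>.\<close>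

lemma geo_power_mult:
  assumes "k \<noteq> l"
  shows "geo k ^ i * geo l \<in> fspan ({geo k ^ j |j. j \<le> i} \<union> {geo l})"
proof (induction i)
  case 0
  then show ?case by (auto intro: fspan_base)
next
  case (Suc i)
  let ?S = "\<lambda>i. fspan ({geo k ^ j |j. j \<le> i} \<union> {geo l})"
  have "geo k ^ Suc i * geo l = geo k ^ i * (geo k * geo l)"
    by (simp add: mult.assoc mult.commute)
  also have "\<dots> = fps_const (of_int k / of_int (k - l)) * geo k ^ Suc i
      - fps_const (of_int l / of_int (k - l)) * (geo k ^ i * geo l)"
    unfolding geo_partial_fractions[OF assms] by (simp add: right_diff_distrib mult_ac)
  finally have *: "geo k ^ Suc i * geo l = \<dots>" .
  have "{geo k ^ j |j. j \<le> i} \<union> {geo l} \<subseteq> {geo k ^ j |j. j \<le> Suc i} \<union> {geo l}"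
    by (auto intro: le_SucI)
  also have "\<dots> \<subseteq> ?S (Suc i)" by (blast intro: fspan_base)
  finally have "geo k ^ i * geo l \<in> ?S (Suc i)" using Suc fspan_mono by blast
  then show ?case
    unfolding * by (intro fspan_diff fspan_scale fspan_base[of "geo k ^ Suc i"]) blast+
qed

text \<open>A new factor \<open>geo l\<close> raises the permitted exponent at \<open>l\<close> by
  one and leaves the other exponents alone.\<close>

lemma geo_prod_partial_fractions:
  "prod_mset (image_mset geo A) \<in> fspan {geo k ^ i |k i. i \<le> count A k}"
proof (induction A)
  case empty
  show ?case by (auto intro!: fspan_base)
next
  case (add l A)
  let ?T = "{geo k ^ i |k i. i \<le> count (add_mset l A) k}"
  have "geo l \<in> ?T" by (rule CollectI, rule exI[of _ l], rule exI[of _ 1]) simp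
  have "f * g \<in> fspan ?T" if fg: "f \<in> {geo k ^ i |k i. i \<le> count A k}" "g \<in> {geo l}" for f g
  proof -
    obtain k i where f: "f = geo k ^ i" "i \<le> count A k" using fg(1) by auto
    show ?thesis
    proof (cases "k = l")
      case True
      have "f * g = geo l ^ Suc i" using True f fg by (simp add: mult.commute)
      moreover have "Suc i \<le> count (add_mset l A) l" using True f by simp
      ultimately show ?thesis by (blast intro: fspan_base)
    next
      case False
      have "geo k ^ j \<in> ?T" if "j \<le> i" for j
        using that f(2) False by (intro CollectI exI[of _ k] exI[of _ j]) simp
      with \<open>geo l \<in> ?T\<close> have "{geo k ^ j |j. j \<le> i} \<union> {geo l} \<subseteq> ?T" by blast
      also have "?T \<subseteq> fspan ?T" by (rule subsetI) (rule fspan_base)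
      finally have "{geo k ^ j |j. j \<le> i} \<union> {geo l} \<subseteq> fspan ?T" .
      with geo_power_mult[OF False, of i] fspan_mono show ?thesis
        using f fg by blast
    qed
  qed
  from fspan_mult[OF this add.IH fspan_base[of "geo l" "{geo l}"]] show ?case
    by (simp add: mult.commute)
qed

text \<open>The negative binomial series; the coefficient recursion turns into Pascal's
  rule.\<close>

lemma geo_power_nth: "(geo k ^ Suc i) $ b = of_nat ((b + i) choose i) * of_int k ^ b"
proof (induction i arbitrary: b)
  case 0
  have "(1 * geo k) $ b = of_int k ^ b"
    by (induction b) (simp_all only: geo_mult_nth, simp_all)
  then show ?case by simp
next
  case (Suc i)
  note IH = Suc.IH
  have "(geo k ^ Suc i * geo k) $ b = of_nat ((b + Suc i) choose Suc i) * of_int k ^ b"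
  proof (induction b)
    case 0
    show ?case unfolding geo_mult_nth Suc by simp
  next
    case (Suc b)
    have "(geo k ^ Suc i * geo k) $ Suc b = of_nat ((Suc b + i) choose i) * of_int k ^ Suc b
      + of_int k * (of_nat ((b + Suc i) choose Suc i) * of_int k ^ b)"
      unfolding geo_mult_nth Suc.IH IH by simp
    also have "\<dots> = of_nat (((b + Suc i) choose i) + ((b + Suc i) choose Suc i)) * of_int k ^ Suc b"
      by (simp add: algebra_simps)
    finally show ?case by simp
  qed
  then show ?case by (simp add: mult.commute)
qed

text \<open>Passing from \<open>i\<close> to \<open>Suc i\<close> multiplies the polynomial by
  \<open>(b + Suc i) / Suc i\<close>. The degree bound later makes a pole of order \<open>i\<close>
  contribute powers of \<open>b\<close> up to \<open>i - 1\<close> only.\<close>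

lemma binomial_polynomial:
  "\<exists>c :: nat \<Rightarrow> rat. \<forall>b. of_nat ((b + i) choose i) = (\<Sum>j\<le>i. c j * of_nat b ^ j)"
proof -
  have "\<exists>p :: rat poly. degree p \<le> i \<and> (\<forall>b. of_nat ((b + i) choose i) = poly p (of_nat b))"
  proof (induction i)
    case 0
    show ?case by (intro exI[of _ 1]) simp
  next
    case (Suc i)
    then obtain p :: "rat poly" where p: "degree p \<le> i"
      "\<And>b. of_nat ((b + i) choose i) = poly p (of_nat b)" by blast
    let ?q = "smult (inverse (of_nat (Suc i))) ([:of_nat (Suc i), 1:] * p)"
    have "degree ?q \<le> Suc i"
      using degree_mult_le[of "[:of_nat (Suc i), 1:]" p] p(1)
      by (intro order.trans[OF degree_smult_le]) simp
    moreover have "of_nat ((b + Suc i) choose Suc i) = poly ?q (of_nat b)" for b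
    proof -
      have "Suc i * ((b + Suc i) choose Suc i) = (b + Suc i) * ((b + i) choose i)"
        using Suc_times_binomial_eq[of "b + i" i] by (simp add: mult.commute)
      then have "of_nat (Suc i) * of_nat ((b + Suc i) choose Suc i) =
          of_nat (b + Suc i) * poly p (of_nat b)"
        unfolding p(2)[symmetric] of_nat_mult[symmetric] by (simp only:)
      moreover have "poly ?q (of_nat b) =
          inverse (of_nat (Suc i)) * (of_nat (b + Suc i) * poly p (of_nat b))"
        by (simp add: algebra_simps)
      ultimately show ?thesis
        by (metis left_inverse mult.assoc mult_1 of_nat_eq_0_iff nat.distinct(1))
    qed
    ultimately show ?case by blast
  qed
  then obtain p :: "rat poly" where p: "degree p \<le> i"
      "\<And>b. of_nat ((b + i) choose i) = poly p (of_nat b)" by blast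
  have "poly p x = (\<Sum>j\<le>i. coeff p j * x ^ j)" for x
    unfolding poly_altdef using p(1) by (intro sum.mono_neutral_left) (auto simp: coeff_eq_0)
  with p(2) show ?thesis by metis
qed

text \<open>The index \<open>k = 0\<close> is not restricted, as \<open>geo 0 = 1\<close>; but \<open>quasi 0\<close> is trivial.\<close>

definition quasi :: "nat \<Rightarrow> rat fps set" where
  "quasi n = fspan {prod_mset (image_mset geo A) |A. \<forall>k. nat \<bar>k\<bar> * count A k < n}"

lemma quasi_mult:
  assumes "f \<in> quasi m" "g \<in> quasi n"
  shows "f * g \<in> quasi (m + n)"
  unfolding quasi_def
proof (rule fspan_mult[OF _ assms[unfolded quasi_def]])
  fix f g assume "f \<in> {prod_mset (image_mset geo A) |A. \<forall>k. nat \<bar>k\<bar> * count A k < m}"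
    and "g \<in> {prod_mset (image_mset geo A) |A. \<forall>k. nat \<bar>k\<bar> * count A k < n}"
  then obtain A B where A: "f = prod_mset (image_mset geo A)" "\<And>k. nat \<bar>k\<bar> * count A k < m"
    and B: "g = prod_mset (image_mset geo B)" "\<And>k. nat \<bar>k\<bar> * count B k < n" by auto
  have "nat \<bar>k\<bar> * count (A + B) k < m + n" for k
    using A(2)[of k] B(2)[of k] by (simp add: distrib_left)
  moreover have "f * g = prod_mset (image_mset geo (A + B))" by (simp add: A B)
  ultimately show "f * g \<in> fspan {prod_mset (image_mset geo A) |A. \<forall>k. nat \<bar>k\<bar> * count A k < m + n}"
    by (blast intro: fspan_base)
qed

text \<open>For \<open>b\<close> of fixed parity, the powers of \<open>-k\<close> and
  \<open>k\<close> differ by a constant sign, so the poles at \<open>1/k\<close> and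
  \<open>-1/k\<close> share one family of coefficients. The constant series 1 shows only at
  \<open>b = 0\<close>, which is excluded.\<close>

lemma quasi_nth:
  fixes e :: nat
  assumes "f \<in> quasi d"
  shows "\<exists>C. \<forall>b>0. even b = even e \<longrightarrow>
    f $ b = (\<Sum>k = 1..d - 1. \<Sum>i = 1..(d - 1) div k. C k i * of_nat b ^ (i - 1) * of_nat k ^ b)"
    (is "?P f")
proof -
  let ?T = "{geo k ^ i |k i. nat \<bar>k\<bar> * i < d}"
  have "{prod_mset (image_mset geo A) |A. \<forall>k. nat \<bar>k\<bar> * count A k < d} \<subseteq> fspan ?T"
  proof safe
    fix A :: "int multiset" assume A: "\<forall>k. nat \<bar>k\<bar> * count A k < d"
    have "{geo k ^ i |k i. i \<le> count A k} \<subseteq> ?T"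
    proof safe
      fix k i assume "i \<le> count A k"
      then have "nat \<bar>k\<bar> * i \<le> nat \<bar>k\<bar> * count A k" by simp
      also have "\<dots> < d" using A by blast
      finally show "\<exists>k' i'. geo k ^ i = geo k' ^ i' \<and> nat \<bar>k'\<bar> * i' < d" by blast
    qed
    also have "?T \<subseteq> fspan ?T" by (rule subsetI) (rule fspan_base)
    finally have "{geo k ^ i |k i. i \<le> count A k} \<subseteq> fspan ?T" .
    with geo_prod_partial_fractions[of A] fspan_mono
    show "prod_mset (image_mset geo A) \<in> fspan ?T" by blast
  qed
  with assms fspan_mono have "f \<in> fspan ?T" unfolding quasi_def by blast
  then show ?thesis
  proof induction
    case fspan_zero
    show ?case by (intro exI[of _ "\<lambda>_ _. 0"]) simp
  next
    case (fspan_add f g)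
    then obtain C D where
      "\<forall>b>0. even b = even e \<longrightarrow>
        f $ b = (\<Sum>k = 1..d - 1. \<Sum>i = 1..(d - 1) div k. C k i * of_nat b ^ (i - 1) * of_nat k ^ b)"
      "\<forall>b>0. even b = even e \<longrightarrow>
        g $ b = (\<Sum>k = 1..d - 1. \<Sum>i = 1..(d - 1) div k. D k i * of_nat b ^ (i - 1) * of_nat k ^ b)"
      by blast
    then show ?case
      by (intro exI[of _ "\<lambda>k i. C k i + D k i"]) (simp add: distrib_right sum.distrib)
  next
    case (fspan_scale f c)
    then obtain C where
      "\<forall>b>0. even b = even e \<longrightarrow>
        f $ b = (\<Sum>k = 1..d - 1. \<Sum>i = 1..(d - 1) div k. C k i * of_nat b ^ (i - 1) * of_nat k ^ b)"
      by blast
    then show ?case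
      by (intro exI[of _ "\<lambda>k i. c * C k i"]) (simp add: sum_distrib_left mult.assoc)
  next
    case (fspan_base f)
    then obtain l n where f: "f = geo l ^ n" "nat \<bar>l\<bar> * n < d" by auto
    show ?case
    proof (cases "l = 0 \<or> n = 0")
      case True
      with f have "f = 1" by auto
      then show ?thesis by (intro exI[of _ "\<lambda>_ _. 0"]) simp
    next
      case False
      define m where "m = nat \<bar>l\<bar>"
      have m: "1 \<le> m" "m * n \<le> d - 1" using False f by (auto simp: m_def)
      \<comment> \<open>The strict bound by \<open>d\<close> yields both ranges of summation:
        \<open>n \<le> (d - 1) div m\<close> and, as \<open>n\<close> is positive,
        \<open>m \<le> d - 1\<close>.\<close>
      have n: "n \<le> (d - 1) div m" using m by (simp add: less_eq_div_iff_mult_less_eq mult.commute)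
      have "m \<le> m * n" using False by simp
      also note m(2)
      finally have m': "m \<in> {1..d - 1}" using m by simp
      obtain i where i: "n = Suc i" using False by (cases n) auto
      obtain c :: "nat \<Rightarrow> rat" where c: "\<And>b. of_nat ((b + i) choose i) = (\<Sum>j\<le>i. c j * of_nat b ^ j)"
        using binomial_polynomial by blast
      \<comment> \<open>As \<open>l\<close> is nonzero this is 1 or -1, so
        \<open>\<epsilon> ^ b\<close> equals the constant \<open>\<epsilon> ^ e\<close> on the given
        parity class.\<close>
      define \<epsilon> :: rat where "\<epsilon> = of_int (sgn l)"
      define C where "C k j = (if k = m \<and> j \<le> n then \<epsilon> ^ e * c (j - 1) else 0)" for k j
      have "f $ b = (\<Sum>k = 1..d - 1. \<Sum>i = 1..(d - 1) div k. C k i * of_nat b ^ (i - 1) * of_nat k ^ b)"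
        if "even b = even e" for b
      proof -
        have "of_int l = \<epsilon> * of_nat m"
          by (simp add: \<epsilon>_def m_def sgn_if)
        moreover have "\<epsilon> ^ b = \<epsilon> ^ e"
          using that False by (cases "even b") (auto simp: \<epsilon>_def sgn_if)
        ultimately have l: "of_int l ^ b = \<epsilon> ^ e * of_nat m ^ b" by (simp add: power_mult_distrib)
        have "f $ b = (\<Sum>j\<le>i. c j * of_nat b ^ j) * of_int l ^ b"
          unfolding f i geo_power_nth c ..
        also have "\<dots> = (\<Sum>j\<in>{..<n}. \<epsilon> ^ e * c j * of_nat b ^ j * of_nat m ^ b)"
          unfolding l sum_distrib_right i lessThan_Suc_atMost by (simp add: mult_ac)
        also have "\<dots> = (\<Sum>j = 1..n. \<epsilon> ^ e * c (j - 1) * of_nat b ^ (j - 1) * of_nat m ^ b)"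
          by (rule sum.reindex_bij_witness[of _ "\<lambda>j. j - 1" Suc]) auto
        also have "\<dots> = (\<Sum>j = 1..(d - 1) div m. C m j * of_nat b ^ (j - 1) * of_nat m ^ b)"
          using n by (intro sum.mono_neutral_cong_left) (auto simp: C_def)
        also have "\<dots> = (\<Sum>k = 1..d - 1. if k = m then
            \<Sum>j = 1..(d - 1) div m. C m j * of_nat b ^ (j - 1) * of_nat m ^ b else 0)"
          using m' by simp
        also have "\<dots> = (\<Sum>k = 1..d - 1. \<Sum>i = 1..(d - 1) div k. C k i * of_nat b ^ (i - 1) * of_nat k ^ b)"
          by (intro sum.cong) (auto simp: C_def)
        finally show ?thesis .
      qed
      then show ?thesis by blast
    qed
  qed
qed

section \<open>Pole bound for complete homogeneous polynomials in the Jucys--Murphy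
  operators\<close>

context jucys_murphy
begin

text \<open>On a joint eigenvector, the recursion of \<open>complete\<close> is the coefficient
  recursion for multiplication by \<open>geo (a m)\<close>.\<close>

lemma complete_joint:
  assumes "v \<in> joint n a" "m \<le> n"
  shows "complete m b v = ((\<Prod>i<m. geo (a i)) $ b) *s v"
  using assms(2)
proof (induction m arbitrary: b)
  case (Suc m)
  have "complete (Suc m) b v = (((\<Prod>i<m. geo (a i)) * geo (a m)) $ b) *s v"
  proof (induction b)
    case 0
    have "(\<Prod>i<m. geo (a i)) $ 0 = 1"
      by (induction m) (simp_all add: geo_def)
    then show ?case by (simp only: geo_mult_nth complete.simps scale_one)
  next
    case (Suc b)
    have "complete (Suc m) (Suc b) v = complete m (Suc b) v + J m (complete (Suc m) b v)"
      by simp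
    also have "J m (complete (Suc m) b v) =
        (of_int (a m) * ((\<Prod>i<m. geo (a i)) * geo (a m)) $ b) *s v"
      unfolding Suc.IH J_scale using assms(1) Suc_le_lessD[OF \<open>Suc m \<le> n\<close>]
      by (simp add: joint_def mult.commute)
    finally show ?case
      unfolding geo_mult_nth using \<open>\<And>b. m \<le> n \<Longrightarrow> _\<close> \<open>Suc m \<le> n\<close>
      by (simp add: scale_left_distrib)
  qed
  then show ?case by (simp add: lessThan_Suc mult.commute)
qed simp

text \<open>The vectors with this property form a subspace, so joint eigenvectors suffice; there the
  series is a multiple of the product of the \<open>geo (a i)\<close>.\<close>

theorem complete_quasi:
  assumes "0 < n" and "\<And>u v. \<phi> (u + v) = \<phi> u + \<phi> v" "\<And>c v. \<phi> (c *s v) = c * \<phi> v"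
  shows "Abs_fps (\<lambda>b. \<phi> (complete n b v)) \<in> quasi n"
proof -
  let ?V = "{v. Abs_fps (\<lambda>b. \<phi> (complete n b v)) \<in> quasi n}"
  have add: "Abs_fps (\<lambda>b. \<phi> (complete n b (u + v))) =
      Abs_fps (\<lambda>b. \<phi> (complete n b u)) + Abs_fps (\<lambda>b. \<phi> (complete n b v))" for u v
    by (simp add: fps_eq_iff complete_add assms)
  have scale: "Abs_fps (\<lambda>b. \<phi> (complete n b (c *s v))) =
      fps_const c * Abs_fps (\<lambda>b. \<phi> (complete n b v))" for c v
    by (simp add: fps_eq_iff complete_scale assms)
  have zero: "Abs_fps (\<lambda>b. \<phi> (complete n b 0)) = 0"
    using scale[of 0 0] by simp
  have "subspace ?V"
    unfolding quasi_def
    by (rule subspaceI) (auto simp: zero add scale intro: fspan.intros)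
  moreover have "(\<Union>a. joint n a) \<subseteq> ?V"
  proof safe
    fix a w assume w: "w \<in> joint n a"
    show "Abs_fps (\<lambda>b. \<phi> (complete n b w)) \<in> quasi n"
    proof (cases "w = 0")
      case True
      then show ?thesis by (simp only: zero) (simp add: quasi_def fspan_zero)
    next
      case False
      with w have a: "a \<in> contents n" by (auto simp: contents_def)
      \<comment> \<open>The multiset of contents: its multiplicities are what
        \<open>contents_card_bound\<close> controls.\<close>
      define A where "A = image_mset a (mset_set {..<n})"
      have "count A k = card {q. q < n \<and> a q = k}" for k
        by (simp add: A_def count_image_mset_eq_card_vimage)
      then have "nat \<bar>k\<bar> * count A k < n" for k
        using contents_card_bound[OF a _ assms(1)] assms(1) by (cases "k = 0") auto
      moreover have "prod_mset (image_mset geo A) = (\<Prod>i<n. geo (a i))"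
        by (simp add: A_def prod_unfold_prod_mset image_mset.compositionality comp_def)
      ultimately have "(\<Prod>i<n. geo (a i)) \<in> quasi n"
        unfolding quasi_def by (intro fspan_base CollectI exI[of _ A]) simp
      moreover have "Abs_fps (\<lambda>b. \<phi> (complete n b w)) = fps_const (\<phi> w) * (\<Prod>i<n. geo (a i))"
        by (simp add: fps_eq_iff complete_joint[OF w] assms)
      ultimately show ?thesis by (simp add: quasi_def fspan_scale)
    qed
  qed
  ultimately show ?thesis using joint_generates[of v n] span_minimal by blast
qed

end

section \<open>Monotone factorizations in the group algebra\<close>

text \<open>The basis consists of all maps on \<open>nat\<close>, permutations or not; right
  composition with a transposition is an involution on all of them.\<close>

type_synonym perm_algebra = "(nat \<Rightarrow> nat) \<Rightarrow>\<^sub>0 rat"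

definition pscale :: "rat \<Rightarrow> perm_algebra \<Rightarrow> perm_algebra" where
  "pscale c v = Poly_Mapping.map ((*) c) v"

text \<open>The map \<open>e\<close> enumerates points, so that one algebra serves every finite set
  of points.\<close>

definition pswap :: "(nat \<Rightarrow> nat) \<Rightarrow> nat \<Rightarrow> perm_algebra \<Rightarrow> perm_algebra" where
  "pswap e i v = Poly_Mapping.map_key (\<lambda>p. p \<circ> transpose (e i) (e (Suc i))) v"

definition pinner :: "perm_algebra \<Rightarrow> perm_algebra \<Rightarrow> rat" where
  "pinner u v = (\<Sum>p\<in>Poly_Mapping.keys u. Poly_Mapping.lookup u p * Poly_Mapping.lookup v p)"

lemma lookup_pscale [simp]: "Poly_Mapping.lookup (pscale c v) p = c * Poly_Mapping.lookup v p"
  by (simp add: pscale_def Poly_Mapping.map.rep_eq when_def)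

lemma lookup_pswap [simp]:
  "Poly_Mapping.lookup (pswap e i v) p = Poly_Mapping.lookup v (p \<circ> transpose (e i) (e (Suc i)))"
proof -
  have "inj (\<lambda>p :: nat \<Rightarrow> nat. p \<circ> transpose (e i) (e (Suc i)))"
    by (rule inj_on_inverseI[where g = "\<lambda>p. p \<circ> transpose (e i) (e (Suc i))"])
      (simp add: fun_eq_iff)
  then show ?thesis by (simp add: pswap_def Poly_Mapping.map_key.rep_eq)
qed

lemma pinner_superset:
  assumes "finite A" "Poly_Mapping.keys u \<subseteq> A"
  shows "pinner u v = (\<Sum>p\<in>A. Poly_Mapping.lookup u p * Poly_Mapping.lookup v p)"
  unfolding pinner_def using assms
  by (intro sum.mono_neutral_left) (auto simp: in_keys_iff)

lemma pinner_sym: "pinner u v = pinner v u"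
  using pinner_superset[of "Poly_Mapping.keys u \<union> Poly_Mapping.keys v" u v]
    pinner_superset[of "Poly_Mapping.keys u \<union> Poly_Mapping.keys v" v u]
  by (simp add: mult.commute)

lemma pinner_pswap: "pinner (pswap e i u) (pswap e i v) = pinner u v"
  unfolding pinner_def
  by (rule sum.reindex_bij_witness[where i = "\<lambda>p. p \<circ> transpose (e i) (e (Suc i))"
        and j = "\<lambda>p. p \<circ> transpose (e i) (e (Suc i))"])
    (auto simp: in_keys_iff comp_assoc)

text \<open>The maps form an orthonormal basis for \<open>pinner\<close>, permuted by each
  \<open>pswap e i\<close>; anisotropy holds because a sum of rational squares vanishes only
  termwise.\<close>

lemma jucys_murphy_perm:
  assumes "inj e"
  shows "jucys_murphy pscale (pswap e) pinner"
proof unfold_locales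
  have ne: "e i \<noteq> e j" if "i \<noteq> j" for i j
    using assms that by (auto dest: injD)
  show "pswap e i (pswap e j v) = pswap e j (pswap e i v)" if "Suc i < j" for i j v
  proof -
    have "transpose (e i) (e (Suc i)) \<circ> transpose (e j) (e (Suc j)) =
        transpose (e j) (e (Suc j)) \<circ> transpose (e i) (e (Suc i))"
      using that by (auto simp: fun_eq_iff transpose_def ne)
    then show ?thesis by (intro poly_mapping_eqI) (simp add: comp_assoc)
  qed
  show "pswap e i (pswap e (Suc i) (pswap e i v)) =
      pswap e (Suc i) (pswap e i (pswap e (Suc i) v))" for i v
  proof -
    have "transpose (e i) (e (Suc i)) \<circ> (transpose (e (Suc i)) (e (Suc (Suc i))) \<circ>
          transpose (e i) (e (Suc i))) =
        transpose (e (Suc i)) (e (Suc (Suc i))) \<circ> (transpose (e i) (e (Suc i)) \<circ>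
          transpose (e (Suc i)) (e (Suc (Suc i))))"
      by (auto simp: fun_eq_iff transpose_def ne)
    then show ?thesis by (intro poly_mapping_eqI) (simp add: comp_assoc)
  qed
  show "pinner (u + w) v = pinner u v + pinner w v" for u v w
  proof -
    let ?A = "Poly_Mapping.keys u \<union> Poly_Mapping.keys w"
    have "Poly_Mapping.keys (u + w) \<subseteq> ?A" by (rule Poly_Mapping.keys_add)
    then show ?thesis
      by (subst (1 2 3) pinner_superset[of ?A])
        (auto simp: lookup_add distrib_right sum.distrib)
  qed
  show "pinner (pscale c u) v = c * pinner u v" for c u v
    by (subst (1 2) pinner_superset[of "Poly_Mapping.keys u"])
      (auto simp: in_keys_iff sum_distrib_left mult.assoc)
  show "v = 0" if "pinner v v = 0" for v
  proof (rule poly_mapping_eqI)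
    fix p
    have "(\<Sum>p\<in>Poly_Mapping.keys v. Poly_Mapping.lookup v p * Poly_Mapping.lookup v p) = 0"
      using that by (simp add: pinner_def)
    then have "\<forall>p\<in>Poly_Mapping.keys v. Poly_Mapping.lookup v p * Poly_Mapping.lookup v p = 0"
      by (subst (asm) sum_nonneg_eq_0_iff) auto
    then show "Poly_Mapping.lookup v p = Poly_Mapping.lookup 0 p"
      by (cases "p \<in> Poly_Mapping.keys v") (auto simp: in_keys_iff)
  qed
qed (auto intro!: poly_mapping_eqI pinner_sym pinner_pswap
    simp: lookup_add distrib_left distrib_right comp_assoc mult.assoc)

text \<open>Conjugating the transposition of \<open>e i\<close> and \<open>e m\<close> by that of
  \<open>e m\<close> and \<open>e (Suc m)\<close> gives the transposition of \<open>e i\<close> and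
  \<open>e (Suc m)\<close>.\<close>

lemma lookup_J:
  assumes "inj e"
  shows "Poly_Mapping.lookup (jucys_murphy.J (pswap e) m v) p =
    (\<Sum>i<m. Poly_Mapping.lookup v (p \<circ> transpose (e i) (e m)))"
proof -
  interpret jucys_murphy pscale "pswap e" pinner
    by (rule jucys_murphy_perm) fact
  have ne: "e i \<noteq> e j" if "i \<noteq> j" for i j
    using assms that by (auto dest: injD)
  show ?thesis
  proof (induction m arbitrary: v p)
    case (Suc m)
    let ?t = "transpose (e m) (e (Suc m))"
    have t: "p \<circ> ?t \<circ> transpose (e i) (e m) \<circ> ?t = p \<circ> transpose (e i) (e (Suc m))" if "i < m" for i
    proof -
      have "?t \<circ> (transpose (e i) (e m) \<circ> ?t) = transpose (e i) (e (Suc m))"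
        using that by (auto simp: fun_eq_iff transpose_def ne)
      then show ?thesis by (simp only: comp_assoc)
    qed
    have "Poly_Mapping.lookup (J (Suc m) v) p =
        (\<Sum>i<m. Poly_Mapping.lookup v (p \<circ> ?t \<circ> transpose (e i) (e m) \<circ> ?t)) +
        Poly_Mapping.lookup v (p \<circ> ?t)"
      by (simp only: J.simps lookup_add lookup_pswap Suc)
    also have "(\<Sum>i<m. Poly_Mapping.lookup v (p \<circ> ?t \<circ> transpose (e i) (e m) \<circ> ?t)) =
        (\<Sum>i<m. Poly_Mapping.lookup v (p \<circ> transpose (e i) (e (Suc m))))"
      by (rule sum.cong[OF refl]) (simp only: t lessThan_iff)
    finally show ?case by (simp only: sum.lessThan_Suc)
  qed simp
qed

section \<open>Monotone lists of transpositions, counted by complete homogeneous polynomials\<close>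

definition mono_lists :: "nat set \<Rightarrow> nat \<Rightarrow> (nat \<times> nat) list set" where
  "mono_lists S b = {L. length L = b \<and> set L \<subseteq> {(x, y). x \<in> S \<and> y \<in> S \<and> x < y} \<and>
     sorted (map snd L)}"

definition lprod :: "(nat \<times> nat) list \<Rightarrow> nat \<Rightarrow> nat" where
  "lprod L = foldr (\<lambda>(x, y) p. transpose x y \<circ> p) L id"

definition facts :: "nat set \<Rightarrow> nat \<Rightarrow> (nat \<Rightarrow> nat) \<Rightarrow> (nat \<times> nat) list set" where
  "facts S b \<rho> = {L \<in> mono_lists S b. lprod L = \<rho>}"

lemma lprod_simps [simp]:
  "lprod [] = id"
  "lprod ((x, y) # L) = transpose x y \<circ> lprod L"
  by (simp_all add: lprod_def)

lemma lprod_append: "lprod (L @ M) = lprod L \<circ> lprod M"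
  by (induction L) (auto simp: comp_assoc)

lemma finite_mono_lists:
  assumes "finite S"
  shows "finite (mono_lists S b)"
proof (rule finite_subset)
  show "mono_lists S b \<subseteq> {L. set L \<subseteq> S \<times> S \<and> length L = b}"
    by (auto simp: mono_lists_def)
  show "finite {L. set L \<subseteq> S \<times> S \<and> length L = b}"
    using assms by (intro finite_lists_length_eq) auto
qed

lemma finite_facts: "finite S \<Longrightarrow> finite (facts S b \<rho>)"
  using finite_mono_lists[of S b] by (simp add: facts_def)

text \<open>Split by the last pair. Its larger point is the greatest of the list, so either it is
  \<open>e n\<close> or no pair involves \<open>e n\<close> at all.\<close>

lemma facts_Suc:
  assumes e: "strict_mono e"
  shows "facts (e ` {..<Suc n}) (Suc b) \<rho> = facts (e ` {..<n}) (Suc b) \<rho> \<union>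
    (\<Union>i<n. (\<lambda>L. L @ [(e i, e n)]) ` facts (e ` {..<Suc n}) b (\<rho> \<circ> transpose (e i) (e n)))"
    (is "?L = ?A \<union> ?B")
proof (intro equalityI subsetI)
  fix L assume L: "L \<in> ?L"
  then have "length L = Suc b" by (simp add: facts_def mono_lists_def)
  then obtain M x y where M: "L = M @ [(x, y)]" "length M = b"
    by (metis length_Suc_conv_rev surj_pair)
  show "L \<in> ?A \<union> ?B"
  proof (cases "y = e n")
    case True
    from L M obtain i where i: "x = e i" "i < Suc n"
      by (auto simp: facts_def mono_lists_def)
    have "x < y" using L M by (auto simp: facts_def mono_lists_def)
    then have "i < n" using i True e by (simp add: strict_mono_less)
    have "lprod M \<circ> transpose x y = \<rho>" using L M by (simp add: facts_def lprod_append)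
    then have "lprod M = \<rho> \<circ> transpose (e i) (e n)" using i True by (auto simp: comp_assoc)
    then have "M \<in> facts (e ` {..<Suc n}) b (\<rho> \<circ> transpose (e i) (e n))"
      using L M by (auto simp: facts_def mono_lists_def sorted_append)
    with \<open>i < n\<close> M i True show ?thesis by blast
  next
    case False
    have *: "x' \<in> e ` {..<n} \<and> y' \<in> e ` {..<n}" if "(x', y') \<in> set L" for x' y'
    proof -
      have "y' \<le> y" using that L M by (auto simp: facts_def mono_lists_def sorted_append)
      moreover have "y \<in> e ` {..<Suc n}" using L M by (auto simp: facts_def mono_lists_def)
      then have "y < e n" using False e by (auto simp: strict_mono_less less_Suc_eq)
      moreover have "x' < y'" "x' \<in> e ` {..<Suc n}" "y' \<in> e ` {..<Suc n}"
        using L that by (auto simp: facts_def mono_lists_def)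
      ultimately show ?thesis by (auto simp: less_Suc_eq)
    qed
    then have "L \<in> ?A" using L by (auto simp: facts_def mono_lists_def)
    then show ?thesis ..
  qed
next
  fix L assume "L \<in> ?A \<union> ?B"
  then show "L \<in> ?L"
  proof
    assume "L \<in> ?A"
    then show ?thesis by (auto simp: facts_def mono_lists_def)
  next
    assume "L \<in> ?B"
    then obtain i M where i: "i < n" and M: "L = M @ [(e i, e n)]"
      "M \<in> facts (e ` {..<Suc n}) b (\<rho> \<circ> transpose (e i) (e n))" by auto
    have "y \<le> e n" if "(x, y) \<in> set M" for x y
    proof -
      have "y \<in> e ` {..<Suc n}" using M that by (auto simp: facts_def mono_lists_def)
      then show ?thesis using e by (auto simp: strict_mono_less_eq)
    qed
    then show ?thesis
      using M i e
      by (auto simp: facts_def mono_lists_def lprod_append sorted_append comp_assoc strict_mono_less)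
  qed
qed

lemma card_facts_Suc:
  assumes e: "strict_mono e"
  shows "card (facts (e ` {..<Suc n}) (Suc b) \<rho>) = card (facts (e ` {..<n}) (Suc b) \<rho>) +
    (\<Sum>i<n. card (facts (e ` {..<Suc n}) b (\<rho> \<circ> transpose (e i) (e n))))"
proof -
  let ?B = "\<lambda>i. (\<lambda>L. L @ [(e i, e n)]) ` facts (e ` {..<Suc n}) b (\<rho> \<circ> transpose (e i) (e n))"
  have fin: "finite (?B i)" for i by (intro finite_imageI finite_facts) auto
  have "facts (e ` {..<n}) (Suc b) \<rho> \<inter> \<Union> (?B ` {..<n}) = {}"
    using e by (auto simp: facts_def mono_lists_def strict_mono_eq)
  moreover have "card (\<Union> (?B ` {..<n})) = (\<Sum>i<n. card (?B i))"
    using fin e by (intro card_UN_disjoint) (auto simp: strict_mono_eq)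
  moreover have "card (?B i) = card (facts (e ` {..<Suc n}) b (\<rho> \<circ> transpose (e i) (e n)))" for i
    by (intro card_image inj_onI) auto
  ultimately show ?thesis
    unfolding facts_Suc[OF e] using fin by (subst card_Un_disjoint) (auto intro: finite_facts)
qed

text \<open>Removing the last pair gives the recursion of \<open>complete\<close>: the pairs ending
  in \<open>e n\<close> together form \<open>J n\<close>.\<close>

lemma card_facts_complete:
  assumes "strict_mono e"
  shows "of_nat (card (facts (e ` {..<n}) b \<rho>)) =
    Poly_Mapping.lookup (jucys_murphy.complete (pswap e) n b (Poly_Mapping.single id 1)) \<rho>"
proof -
  have inj: "inj e" using assms by (rule strict_mono_imp_inj_on)
  interpret jucys_murphy pscale "pswap e" pinner
    by (rule jucys_murphy_perm) fact
  have 0: "facts S 0 \<rho> = (if \<rho> = id then {[]} else {})" for S \<rho>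
    by (auto simp: facts_def mono_lists_def)
  show ?thesis
  proof (induction n b "Poly_Mapping.single id 1 :: perm_algebra" arbitrary: \<rho> rule: complete.induct)
    case (1 b)
    have "facts {} b \<rho> = {}" if "b \<noteq> 0"
      using that by (auto simp: facts_def mono_lists_def)
    then show ?case by (auto simp: 0 lookup_single when_def)
  next
    case (2 n)
    then show ?case by (auto simp: 0 lookup_single when_def)
  next
    case (3 n b)
    show ?case
      by (simp add: card_facts_Suc[OF assms] lookup_add lookup_J[OF inj] 3)
  qed
qed

lemma facts_quasi:
  assumes "finite S" "S \<noteq> {}"
  shows "Abs_fps (\<lambda>b. of_nat (card (facts S b \<rho>))) \<in> quasi (card S)"
proof -
  obtain h where h: "bij_betw h {..<card S} S" "strict_mono_on {..<card S} h"
    using ex_bij_betw_strict_mono_card[OF assms(1)] by blast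
  \<comment> \<open>The increasing enumeration of \<open>S\<close> is continued beyond
    \<open>Max S\<close>, as \<open>e\<close> has to be strictly increasing on all of
    \<open>nat\<close>.\<close>
  define e where "e i = (if i < card S then h i else Suc (Max S) + i)" for i
  have S: "S = e ` {..<card S}"
    using h(1) by (auto simp: bij_betw_def e_def)
  have e: "strict_mono e"
  proof (rule strict_monoI)
    fix i j :: nat assume "i < j"
    have "h i < Suc (Max S)" if "i < card S"
      using h(1) that assms by (auto simp: bij_betw_def less_Suc_eq_le intro!: Max_ge)
    with \<open>i < j\<close> h(2) show "e i < e j"
      by (auto simp: e_def strict_mono_on_def)
  qed
  interpret jucys_murphy pscale "pswap e" pinner
    by (rule jucys_murphy_perm) (rule strict_mono_imp_inj_on[OF e])
  have "0 < card S" using assms by (simp add: card_gt_0_iff)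
  from complete_quasi[OF this, of "\<lambda>v. Poly_Mapping.lookup v \<rho>" "Poly_Mapping.single id 1"]
  show ?thesis
    unfolding card_facts_complete[OF e, of "card S", folded S, symmetric] by (simp add: lookup_add)
qed

section \<open>Connected factorizations\<close>

text \<open>The equivalence relation generated by the pairs, on all of \<open>nat\<close>; points
  that no pair touches form singleton classes.\<close>

definition rel :: "(nat \<times> nat) list \<Rightarrow> (nat \<times> nat) set" where
  "rel L = (set L \<union> (set L)\<inverse>)\<^sup>*"

definition conn :: "nat set \<Rightarrow> (nat \<times> nat) list \<Rightarrow> bool" where
  "conn S L \<longleftrightarrow> S \<times> S \<subseteq> rel L"

lemma rel_edge: "(u, v) \<in> set L \<Longrightarrow> (u, v) \<in> rel L \<and> (v, u) \<in> rel L"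
  by (auto simp: rel_def)

lemma rel_refl [simp]: "(u, u) \<in> rel L"
  by (simp add: rel_def)

lemma rel_trans: "(u, v) \<in> rel L \<Longrightarrow> (v, w) \<in> rel L \<Longrightarrow> (u, w) \<in> rel L"
  unfolding rel_def by (rule rtrancl_trans)

lemma rel_sym: "(u, v) \<in> rel L \<Longrightarrow> (v, u) \<in> rel L"
proof -
  have "sym (rel L)" unfolding rel_def by (intro sym_rtrancl sym_Un_converse)
  then show "(u, v) \<in> rel L \<Longrightarrow> (v, u) \<in> rel L" by (rule symD)
qed

lemma rel_mono: "set L \<subseteq> set M \<Longrightarrow> rel L \<subseteq> rel M"
  unfolding rel_def by (rule rtrancl_mono) auto

lemma rel_invariant:
  assumes "(u, v) \<in> rel L" "u \<in> B" "\<And>x y. (x, y) \<in> set L \<Longrightarrow> x \<in> B \<longleftrightarrow> y \<in> B"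
  shows "v \<in> B"
  using assms(1,2) unfolding rel_def
  by (induction rule: rtrancl_induct) (use assms(3) in auto)

lemma component_subset:
  assumes "L \<in> mono_lists S b" "x \<in> S"
  shows "rel L `` {x} \<subseteq> S"
  using rel_invariant[of x _ L S] assms by (auto simp: mono_lists_def)

lemma conn_iff_component:
  assumes "L \<in> mono_lists S b" "x \<in> S"
  shows "conn S L \<longleftrightarrow> rel L `` {x} = S"
proof
  assume "conn S L"
  then show "rel L `` {x} = S"
    using component_subset[OF assms] assms by (auto simp: conn_def)
next
  assume "rel L `` {x} = S"
  then show "conn S L"
    by (auto simp: conn_def) (metis Image_singleton_iff rel_sym rel_trans)
qed

section \<open>Splitting a monotone list along a connected component\<close>

lemma lprod_permutes:
  assumes "set L \<subseteq> S \<times> S"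
  shows "lprod L permutes S"
  using assms
proof (induction L)
  case (Cons a L)
  obtain x y where a: "a = (x, y)" by fastforce
  have "transpose x y permutes S"
    using Cons.prems by (intro permutes_swap_id) (auto simp: a)
  with Cons show ?case
    unfolding a lprod_simps by (intro permutes_compose) auto
qed (simp add: permutes_id)

text \<open>A transposition of two points outside \<open>B\<close> commutes with the partial
  product, which permutes \<open>B\<close>.\<close>

lemma lprod_filter:
  assumes "\<And>x y. (x, y) \<in> set L \<Longrightarrow> x \<in> B \<longleftrightarrow> y \<in> B"
  shows "lprod L = lprod (filter (\<lambda>e. fst e \<in> B) L) \<circ> lprod (filter (\<lambda>e. fst e \<notin> B) L)"
  using assms
proof (induction L)
  case (Cons a L)
  obtain x y where a: "a = (x, y)" by fastforce
  let ?M = "filter (\<lambda>e. fst e \<in> B) L" and ?N = "filter (\<lambda>e. fst e \<notin> B) L"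
  have IH: "lprod L = lprod ?M \<circ> lprod ?N" by (rule Cons.IH) (use Cons.prems in auto)
  have perm: "lprod ?M permutes B"
    by (rule lprod_permutes) (use Cons.prems in \<open>force\<close>)
  show ?case
  proof (cases "x \<in> B")
    case True
    then show ?thesis by (simp add: a IH comp_assoc)
  next
    case False
    then have "y \<notin> B" using Cons.prems[of x y] by (simp add: a)
    have comm: "transpose x y \<circ> lprod ?M = lprod ?M \<circ> transpose x y"
    proof
      fix z
      have fixed: "lprod ?M x = x" "lprod ?M y = y"
        using perm False \<open>y \<notin> B\<close> by (auto simp: permutes_def)
      have "lprod ?M z = x \<longleftrightarrow> z = x" "lprod ?M z = y \<longleftrightarrow> z = y"
        using permutes_inj[OF perm] fixed by (metis injD)+
      with fixed show "(transpose x y \<circ> lprod ?M) z = (lprod ?M \<circ> transpose x y) z"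
        by (auto simp: transpose_def)
    qed
    have f: "filter (\<lambda>e. fst e \<in> B) (a # L) = ?M" "filter (\<lambda>e. fst e \<notin> B) (a # L) = (x, y) # ?N"
      using False by (simp_all add: a)
    have "lprod (a # L) = transpose x y \<circ> lprod ?M \<circ> lprod ?N"
      by (simp only: a lprod_simps IH comp_assoc)
    also have "\<dots> = lprod ?M \<circ> (transpose x y \<circ> lprod ?N)"
      unfolding comm by (simp only: comp_assoc)
    finally show ?thesis unfolding f lprod_simps .
  qed
qed simp

text \<open>On \<open>B\<close> the right factors are trivial, so \<open>p\<close> and
  \<open>p'\<close> agree there; elsewhere both are the identity. Injectivity of \<open>p\<close>
  then cancels it.\<close>

lemma permutes_disjoint_comp_unique:
  assumes "p permutes B" "p' permutes B" "q permutes C" "q' permutes C" "B \<inter> C = {}"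
    and "p \<circ> q = p' \<circ> q'"
  shows "p = p' \<and> q = q'"
proof -
  have 1: "p z = p' z" for z
  proof (cases "z \<in> B")
    case True
    then have "q z = z" "q' z = z" using assms by (auto simp: permutes_def)
    then show ?thesis using fun_cong[OF assms(6), of z] by simp
  next
    case False
    then show ?thesis using assms by (simp add: permutes_not_in)
  qed
  then have "p = p'" by blast
  with assms permutes_inj[OF assms(1)] show ?thesis
    by (auto simp: fun_eq_iff dest: injD)
qed

text \<open>
  Stability of \<open>sort_key\<close> makes it the inverse of splitting a list into two sublists
  whose second components lie in disjoint sets.
\<close>

lemma mono_list_mergeI:
  assumes "L \<in> mono_lists B i" "M \<in> mono_lists C j" "B \<inter> C = {}"
  defines "K \<equiv> sort_key snd (L @ M)"
  shows "K \<in> mono_lists (B \<union> C) (i + j)"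
    and "filter (\<lambda>e. fst e \<in> B) K = L" "filter (\<lambda>e. fst e \<notin> B) K = M"
    and "\<And>x y. (x, y) \<in> set K \<Longrightarrow> x \<in> B \<longleftrightarrow> y \<in> B"
proof -
  have sorted: "sort_key snd L = L" "sort_key snd M = M"
    using assms by (auto simp: mono_lists_def intro: sort_key_id_if_sorted)
  have L: "filter (\<lambda>e. fst e \<in> B) L = L" "filter (\<lambda>e. fst e \<notin> B) L = []"
    using assms(1) by (auto simp: mono_lists_def filter_id_conv filter_empty_conv)
  have M: "filter (\<lambda>e. fst e \<in> B) M = []" "filter (\<lambda>e. fst e \<notin> B) M = M"
    using assms(2,3) by (auto simp: mono_lists_def filter_id_conv filter_empty_conv)
  show "K \<in> mono_lists (B \<union> C) (i + j)"
    using assms by (auto simp: mono_lists_def)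
  show "filter (\<lambda>e. fst e \<in> B) K = L" "filter (\<lambda>e. fst e \<notin> B) K = M"
    by (simp_all add: K_def filter_sort L M sorted)
  show "x \<in> B \<longleftrightarrow> y \<in> B" if "(x, y) \<in> set K" for x y
    using that assms by (auto simp: mono_lists_def)
qed

lemma mono_list_filter:
  assumes "K \<in> mono_lists S b" "B \<subseteq> S" "\<And>x y. (x, y) \<in> set K \<Longrightarrow> x \<in> B \<longleftrightarrow> y \<in> B"
  defines "L \<equiv> filter (\<lambda>e. fst e \<in> B) K" and "M \<equiv> filter (\<lambda>e. fst e \<notin> B) K"
  shows "L \<in> mono_lists B (length L)" "M \<in> mono_lists (S - B) (length M)"
    and "length L + length M = b" and "sort_key snd (L @ M) = K"
proof -
  show "L \<in> mono_lists B (length L)" "M \<in> mono_lists (S - B) (length M)"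
    using assms(1-3) by (auto simp: mono_lists_def L_def M_def sorted_filter)
  show "length L + length M = b"
    using assms(1) sum_length_filter_compl[of "\<lambda>e. fst e \<in> B" K]
    by (simp add: L_def M_def mono_lists_def)
  show "sort_key snd (L @ M) = K"
  proof (rule properties_for_sort_key)
    show "mset K = mset (L @ M)"
      by (simp add: L_def M_def)
    show "sorted (map snd K)" using assms(1) by (simp add: mono_lists_def)
    \<comment> \<open>Pairs with the same larger point all lie on the same side of the split, so
      ties keep their original order.\<close>
    show "filter (\<lambda>e. snd k = snd e) K = filter (\<lambda>e. snd k = snd e) (L @ M)" if "k \<in> set K" for k
    proof (cases "snd k \<in> B")
      case True
      have "filter (\<lambda>e. snd k = snd e) M = []"
        using True assms(3) by (auto simp: M_def filter_empty_conv)
      moreover have "filter (\<lambda>e. snd k = snd e) L = filter (\<lambda>e. snd k = snd e) K"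
        unfolding L_def filter_filter using True assms(3) by (intro filter_cong) auto
      ultimately show ?thesis by simp
    next
      case False
      have "filter (\<lambda>e. snd k = snd e) L = []"
        using False assms(3) by (auto simp: L_def filter_empty_conv)
      moreover have "filter (\<lambda>e. snd k = snd e) M = filter (\<lambda>e. snd k = snd e) K"
        unfolding M_def filter_filter using False assms(3) by (intro filter_cong) auto
      ultimately show ?thesis by simp
    qed
  qed
qed

text \<open>The component of \<open>x\<close> is \<open>B\<close> exactly when no pair joins
  \<open>B\<close> to its complement and the pairs inside connect \<open>B\<close>. Filtering and
  merging are then mutually inverse.\<close>

lemma card_component:
  assumes "finite S" "x \<in> B" "B \<subseteq> S"
  shows "card {K \<in> facts S b \<rho>. rel K `` {x} = B} =
    (\<Sum>i\<le>b. card {(L, M). L \<in> mono_lists B i \<and> conn B L \<and> M \<in> mono_lists (S - B) (b - i) \<and>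
        lprod L \<circ> lprod M = \<rho>})" (is "card ?A = (\<Sum>i\<le>b. card (?P i))")
proof -
  have fin: "finite (?P i)" for i
  proof (rule finite_subset)
    show "?P i \<subseteq> mono_lists B i \<times> mono_lists (S - B) (b - i)" by auto
    show "finite \<dots>" using assms finite_subset by (intro finite_cartesian_product finite_mono_lists) auto
  qed
  let ?f = "\<lambda>K. (filter (\<lambda>e. fst e \<in> B) K, filter (\<lambda>e. fst e \<notin> B) K)"
  let ?g = "\<lambda>(L, M). sort_key snd (L @ M)"
  have "card ?A = card (\<Union>i\<le>b. ?P i)"
  proof (rule bij_betw_same_card, rule bij_betw_byWitness[where f = ?f and f' = ?g])
    have inv: "u \<in> B \<longleftrightarrow> v \<in> B" if "K \<in> ?A" "(u, v) \<in> set K" for K u v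
      using that rel_edge[of u v K] by (auto dest: rel_trans)
    note split = mono_list_filter[OF _ assms(3) inv]
    show "\<forall>K\<in>?A. ?g (?f K) = K"
      using split(4) by (auto simp: facts_def)
    show "?f ` ?A \<subseteq> (\<Union>i\<le>b. ?P i)"
    proof (rule image_subsetI)
      fix K assume "K \<in> ?A"
      then have K: "K \<in> facts S b \<rho>" "B = rel K `` {x}" by auto
      then have KA: "K \<in> ?A" and Km: "K \<in> mono_lists S b" by (auto simp: facts_def)
      note s = split[OF Km KA]
      let ?L = "filter (\<lambda>e. fst e \<in> B) K"
      \<comment> \<open>A path starting at \<open>x\<close> never leaves \<open>B\<close>, hence
        uses only pairs kept in \<open>?L\<close>.\<close>
      have "y \<in> {y \<in> B. (x, y) \<in> rel ?L}" if "(x, y) \<in> rel K" for y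
        using that unfolding rel_def[of K]
      proof (induction rule: rtrancl_induct)
        case base
        then show ?case using assms by simp
      next
        case (step y z)
        have "z \<in> B" using step inv[OF KA, of y z] inv[OF KA, of z y] by auto
        moreover have "(y, z) \<in> set ?L \<or> (z, y) \<in> set ?L" using step \<open>z \<in> B\<close> by auto
        then have "(y, z) \<in> rel ?L" using rel_edge by blast
        ultimately show ?case using step rel_trans by blast
      qed
      then have "B \<subseteq> rel ?L `` {x}" using K(2) by blast
      moreover have "rel ?L `` {x} \<subseteq> B" using component_subset[OF s(1) assms(2)] .
      ultimately have "conn B ?L" using conn_iff_component[OF s(1) assms(2)] by blast
      moreover have "lprod ?L \<circ> lprod (filter (\<lambda>e. fst e \<notin> B) K) = \<rho>"
        using lprod_filter[of K B] inv[OF KA] K by (simp add: facts_def)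
      ultimately show "?f K \<in> (\<Union>i\<le>b. ?P i)"
        using s by (intro UN_I[of "length ?L"]) auto
    qed
    have merge: "?f (?g LM) = LM \<and> ?g LM \<in> ?A" if LM: "LM \<in> (\<Union>i\<le>b. ?P i)" for LM
    proof -
      obtain L M i where i: "i \<le> b" and LM: "LM = (L, M)" "L \<in> mono_lists B i" "conn B L"
        "M \<in> mono_lists (S - B) (b - i)" "lprod L \<circ> lprod M = \<rho>" using LM by blast
      note m = mono_list_mergeI[OF LM(2,4)]
      let ?K = "sort_key snd (L @ M)"
      have "rel ?K `` {x} \<subseteq> B" using rel_invariant[of x _ ?K B] m(4) assms by blast
      moreover have "B \<subseteq> rel ?K `` {x}"
        using LM(3) assms(2) rel_mono[of L ?K] by (auto simp: conn_def)
      moreover have "lprod ?K = \<rho>"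
        using lprod_filter[of ?K B] m(2,3,4) LM by auto
      moreover have "?K \<in> mono_lists S b"
        using m(1) i assms(3) by (simp add: Un_absorb1)
      ultimately show ?thesis using m(2,3) LM by (auto simp: facts_def)
    qed
    then show "\<forall>LM\<in>(\<Union>i\<le>b. ?P i). ?f (?g LM) = LM" "?g ` (\<Union>i\<le>b. ?P i) \<subseteq> ?A" by blast+
  qed
  also have "\<dots> = (\<Sum>i\<le>b. card (?P i))"
  proof (rule card_UN_disjoint)
    show "\<forall>i\<in>{..b}. finite (?P i)" using fin by blast
    show "\<forall>i\<in>{..b}. \<forall>j\<in>{..b}. i \<noteq> j \<longrightarrow> ?P i \<inter> ?P j = {}"
      by (auto simp: mono_lists_def)
  qed simp
  finally show ?thesis .
qed

section \<open>Generating functions of connected lists\<close>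

definition conn_facts :: "nat set \<Rightarrow> nat \<Rightarrow> (nat \<Rightarrow> nat) \<Rightarrow> (nat \<times> nat) list set" where
  "conn_facts S b \<rho> = {L \<in> facts S b \<rho>. conn S L}"

text \<open>The supports are disjoint, so \<rho> determines both partial products: once a single
  splitting exists, every splitting has the same two products. Summing over the lengths gives a
  Cauchy product.\<close>

lemma component_series:
  assumes "finite S" "x \<in> B" "B \<subseteq> S"
  shows "(\<forall>b. {K \<in> facts S b \<rho>. rel K `` {x} = B} = {}) \<or>
    (\<exists>\<rho>1 \<rho>2. Abs_fps (\<lambda>b. of_nat (card {K \<in> facts S b \<rho>. rel K `` {x} = B})) =
      (Abs_fps (\<lambda>b. of_nat (card (conn_facts B b \<rho>1))) * Abs_fps (\<lambda>b. of_nat (card (facts (S - B) b \<rho>2)))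
        :: rat fps))"
proof -
  let ?P = "\<lambda>i j. {(L, M). L \<in> mono_lists B i \<and> conn B L \<and> M \<in> mono_lists (S - B) j \<and>
        lprod L \<circ> lprod M = \<rho>}"
  have fin: "finite {K \<in> facts S b \<rho>. rel K `` {x} = B}" for b
    using finite_facts[OF assms(1)] by simp
  note card = card_component[OF assms]
  show ?thesis
  proof (cases "\<forall>i j. ?P i j = {}")
    case True
    then have "card {K \<in> facts S b \<rho>. rel K `` {x} = B} = 0" for b
      using True by (simp only: card card.empty sum.neutral_const)
    then show ?thesis using fin by simp
  next
    case False
    then obtain L0 M0 i0 j0 where 0: "L0 \<in> mono_lists B i0" "M0 \<in> mono_lists (S - B) j0"
      "lprod L0 \<circ> lprod M0 = \<rho>" by blast
    have perm: "lprod L permutes T" if "L \<in> mono_lists T i" for L T i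
      using that by (intro lprod_permutes) (auto simp: mono_lists_def)
    have "?P i j = conn_facts B i (lprod L0) \<times> facts (S - B) j (lprod M0)" for i j
    proof -
      have "lprod L \<circ> lprod M = \<rho> \<longleftrightarrow> lprod L = lprod L0 \<and> lprod M = lprod M0"
        if "L \<in> mono_lists B i" "M \<in> mono_lists (S - B) j" for L M
        using permutes_disjoint_comp_unique[OF perm[OF that(1)] perm[OF 0(1)] perm[OF that(2)] perm[OF 0(2)]]
          0(3) by auto
      then show ?thesis by (auto simp: conn_facts_def facts_def)
    qed
    then have "Abs_fps (\<lambda>b. of_nat (card {K \<in> facts S b \<rho>. rel K `` {x} = B})) =
      (Abs_fps (\<lambda>b. of_nat (card (conn_facts B b (lprod L0)))) *
        Abs_fps (\<lambda>b. of_nat (card (facts (S - B) b (lprod M0)))) :: rat fps)"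
      unfolding fps_eq_iff card fps_mult_nth
      by (simp add: card_cartesian_product atMost_atLeast0)
    then show ?thesis by blast
  qed
qed

text \<open>From all factorizations subtract those where the component of a fixed point
  \<open>x\<close> is a proper subset \<open>B\<close>. Their series is zero or a product bounded by
  induction on \<open>B\<close> and by \<open>facts_quasi\<close> on the nonempty rest.\<close>

theorem conn_facts_quasi:
  assumes "finite S" "S \<noteq> {}"
  shows "Abs_fps (\<lambda>b. of_nat (card (conn_facts S b \<rho>))) \<in> quasi (card S)"
  using assms
proof (induction "card S" arbitrary: S \<rho> rule: less_induct)
  case less
  obtain x where x: "x \<in> S" using less.prems by blast
  let ?F = "\<lambda>B. Abs_fps (\<lambda>b. of_nat (card {K \<in> facts S b \<rho>. rel K `` {x} = B})) :: rat fps"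
  let ?Bs = "{B. x \<in> B \<and> B \<subset> S}"
  have fin: "finite ?Bs" using less.prems by (intro finite_subset[of ?Bs "Pow S"]) auto
  have "card (facts S b \<rho>) = card (conn_facts S b \<rho>) +
      (\<Sum>B\<in>?Bs. card {K \<in> facts S b \<rho>. rel K `` {x} = B})" for b
  proof -
    have "L \<in> conn_facts S b \<rho> \<longleftrightarrow> rel L `` {x} \<notin> ?Bs" if "L \<in> facts S b \<rho>" for L
    proof -
      have "L \<in> mono_lists S b" using that by (simp add: facts_def)
      then have "conn S L \<longleftrightarrow> rel L `` {x} = S" "rel L `` {x} \<subseteq> S"
        using x by (rule conn_iff_component, rule component_subset)
      moreover have "x \<in> rel L `` {x}" by simp
      ultimately show ?thesis using that unfolding conn_facts_def by blast
    qed
    moreover have "conn_facts S b \<rho> \<subseteq> facts S b \<rho>" by (auto simp: conn_facts_def)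
    ultimately have eq: "facts S b \<rho> = conn_facts S b \<rho> \<union> (\<Union>B\<in>?Bs. {K \<in> facts S b \<rho>. rel K `` {x} = B})"
      and disj: "conn_facts S b \<rho> \<inter> (\<Union>B\<in>?Bs. {K \<in> facts S b \<rho>. rel K `` {x} = B}) = {}"
      by blast+
    have card_U: "card (\<Union>B\<in>?Bs. {K \<in> facts S b \<rho>. rel K `` {x} = B}) =
        (\<Sum>B\<in>?Bs. card {K \<in> facts S b \<rho>. rel K `` {x} = B})"
      using fin finite_facts[OF less.prems(1)] by (intro card_UN_disjoint) auto
    have "finite (conn_facts S b \<rho>)" "finite (\<Union>B\<in>?Bs. {K \<in> facts S b \<rho>. rel K `` {x} = B})"
      using fin finite_facts[OF less.prems(1)] by (simp_all add: conn_facts_def)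
    from card_Un_disjoint[OF this disj] show ?thesis
      by (simp only: eq[symmetric] card_U)
  qed
  then have "Abs_fps (\<lambda>b. of_nat (card (facts S b \<rho>))) =
      Abs_fps (\<lambda>b. of_nat (card (conn_facts S b \<rho>))) + (\<Sum>B\<in>?Bs. ?F B)"
    by (simp add: fps_eq_iff fps_sum_nth)
  then have eq: "Abs_fps (\<lambda>b. of_nat (card (conn_facts S b \<rho>))) =
      Abs_fps (\<lambda>b. of_nat (card (facts S b \<rho>))) - (\<Sum>B\<in>?Bs. ?F B)"
    by simp
  have "?F B \<in> quasi (card S)" if "B \<in> ?Bs" for B
  proof -
    have B: "x \<in> B" "B \<subseteq> S" "B \<noteq> S" using that by auto
    have finB: "finite B" using B less.prems finite_subset by blast
    from component_series[OF less.prems(1) B(1,2), of \<rho>] show ?thesis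
    proof
      assume "\<forall>b. {K \<in> facts S b \<rho>. rel K `` {x} = B} = {}"
      then have "card {K \<in> facts S b \<rho>. rel K `` {x} = B} = 0" for b
        by (simp only: card.empty)
      then have "?F B = 0" by (simp add: fps_eq_iff)
      then show ?thesis by (simp add: quasi_def fspan_zero)
    next
      assume "\<exists>\<rho>1 \<rho>2. ?F B = Abs_fps (\<lambda>b. of_nat (card (conn_facts B b \<rho>1))) *
        Abs_fps (\<lambda>b. of_nat (card (facts (S - B) b \<rho>2)))"
      then obtain \<rho>1 \<rho>2 where F: "?F B = Abs_fps (\<lambda>b. of_nat (card (conn_facts B b \<rho>1))) *
        Abs_fps (\<lambda>b. of_nat (card (facts (S - B) b \<rho>2)))" by blast
      have "Abs_fps (\<lambda>b. of_nat (card (conn_facts B b \<rho>1))) \<in> quasi (card B)"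
        using less.hyps[of B \<rho>1] B finB less.prems by (auto intro: psubset_card_mono)
      moreover have "Abs_fps (\<lambda>b. of_nat (card (facts (S - B) b \<rho>2))) \<in> quasi (card (S - B))"
        by (rule facts_quasi) (use B less.prems in auto)
      ultimately have "?F B \<in> quasi (card B + card (S - B))" unfolding F by (rule quasi_mult)
      also have "card B + card (S - B) = card S"
        using B less.prems finB by (simp add: card_Diff_subset card_mono)
      finally show ?thesis .
    qed
  qed
  then have "(\<Sum>B\<in>?Bs. ?F B) \<in> quasi (card S)"
    unfolding quasi_def by (rule fspan_sum)
  with facts_quasi[OF less.prems] show ?case
    unfolding eq unfolding quasi_def by (rule fspan_diff)
qed

section \<open>Transitive tuples of permutations\<close>

lemma orbit_transpose:
  "Orbits.orbit (transpose a c) x = (if x = a \<or> x = c then {a, c} else {x})"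
proof -
  let ?T = "if x = a \<or> x = c then {a, c} else {x}"
  have "y \<in> ?T" if "y \<in> Orbits.orbit (transpose a c) x" for y
    using that by induction (auto simp: transpose_def split: if_splits)
  then have "Orbits.orbit (transpose a c) x \<subseteq> ?T" by blast
  moreover have "x \<in> Orbits.orbit (transpose a c) x"
    by (intro permutation_self_in_orbit) (simp add: permutation_swap_id)
  moreover have "transpose a c x \<in> Orbits.orbit (transpose a c) x" by (rule orbit.base)
  ultimately have "?T \<subseteq> Orbits.orbit (transpose a c) x"
    by (auto simp: transpose_def split: if_splits)
  with \<open>_ \<subseteq> ?T\<close> show ?thesis by (rule equalityI)
qed

lemma transpose_in_transpositions:
  assumes "a < c"
  shows "transpose a c \<in> transpositions d \<longleftrightarrow> a \<in> {1..d} \<and> c \<in> {1..d}"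
proof
  assume "transpose a c \<in> transpositions d"
  then have p: "transpose a c permutes {1..d}"
    by (simp add: cycle_class_def sym_group_carrier)
  show "a \<in> {1..d} \<and> c \<in> {1..d}"
    using permutes_not_in[OF p, of a] permutes_not_in[OF p, of c] assms by auto
next
  assume ac: "a \<in> {1..d} \<and> c \<in> {1..d}"
  let ?X = "{1..d} - {a, c}"
  have "Orbits.orbit (transpose a c) ` {1..d} = insert {a, c} ((\<lambda>x. {x}) ` ?X)"
    using ac by (auto simp: orbit_transpose)
  moreover have "{a, c} \<notin> (\<lambda>x. {x}) ` ?X" by auto
  moreover have "image_mset card (mset_set ((\<lambda>x. {x}) ` ?X)) = replicate_mset (card ?X) 1"
    by (subst image_mset_mset_set[symmetric])
      (auto simp: image_mset.compositionality comp_def image_mset_const_eq)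
  moreover have "card ?X = d - 2" using ac assms by (subst card_Diff_subset) auto
  ultimately have "cycle_lengths d (transpose a c) = mset (2 # replicate (d - 2) 1)"
    using assms by (simp add: cycle_lengths_def)
  then show "transpose a c \<in> transpositions d"
    using ac by (simp add: cycle_class_def sym_group_carrier permutes_swap_id)
qed

text \<open>Being a group action is part of \<open>transitive_action\<close>; once it is
  established, transitivity is a statement about single points.\<close>

lemma restrict_group_action:
  assumes "S \<subseteq> carrier (sym_group d)"
  shows "group_action ((sym_group d)\<lparr>carrier := generate (sym_group d) S\<rparr>) {1..d}
    (\<lambda>p. restrict p {1..d})"
proof -
  interpret group "sym_group d" by (rule sym_group_is_group)
  have sub: "generate (sym_group d) S \<subseteq> carrier (sym_group d)"
    using generate_incl[OF assms] .
  have bij: "restrict p {1..d} \<in> Bij {1..d}" if "p permutes {1..d}" for p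
    using bij_betw_restrict_eq[of p "{1..d}" "{1..d}"] permutes_imp_bij[OF that]
    by (simp add: Bij_def)
  have "(\<lambda>p. restrict p {1..d}) \<in>
      hom ((sym_group d)\<lparr>carrier := generate (sym_group d) S\<rparr>) (BijGroup {1..d})"
  proof (rule homI)
    fix p q assume "p \<in> carrier ((sym_group d)\<lparr>carrier := generate (sym_group d) S\<rparr>)"
      "q \<in> carrier ((sym_group d)\<lparr>carrier := generate (sym_group d) S\<rparr>)"
    then have pq: "p permutes {1..d}" "q permutes {1..d}"
      using sub by (auto simp: sym_group_carrier)
    have "restrict (p \<circ> q) {1..d} = compose {1..d} (restrict p {1..d}) (restrict q {1..d})"
      using permutes_in_image[OF pq(2)] by (auto simp: compose_def restrict_def fun_eq_iff)
    then show "restrict (p \<otimes>\<^bsub>(sym_group d)\<lparr>carrier := generate (sym_group d) S\<rparr>\<^esub> q) {1..d} =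
        restrict p {1..d} \<otimes>\<^bsub>BijGroup {1..d}\<^esub> restrict q {1..d}"
      using bij pq by (simp add: BijGroup_def sym_group_mult)
  qed (use sub bij in \<open>auto simp: sym_group_carrier BijGroup_def\<close>)
  then show ?thesis
    unfolding group_action_def group_hom_def group_hom_axioms_def
    using subgroup_imp_group[OF generate_is_subgroup[OF assms]] group_BijGroup by auto
qed

lemma rel_lprod: "(z, lprod L z) \<in> rel L"
proof (induction L)
  case (Cons a L)
  obtain x y where a: "a = (x, y)" by fastforce
  have "(z, lprod L z) \<in> rel (a # L)" using Cons rel_mono[of L "a # L"] by auto
  moreover have "(lprod L z, transpose x y (lprod L z)) \<in> rel (a # L)"
    using rel_edge[of x y "a # L"] by (auto simp: a transpose_def)
  ultimately show ?case by (simp add: a) (rule rel_trans)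
qed simp

text \<open>Since \<rho> inverts \<open>lprod L\<close>, it moves every point within its component,
  as the transpositions do; so does the whole group. Conversely, the transpositions along a path
  multiply to an element carrying one end to the other.\<close>

lemma generates_transitive_iff_conn:
  assumes "L \<in> mono_lists {1..d} b" "\<rho> permutes {1..d}" "\<rho> \<circ> lprod L = id"
  shows "generates_transitive d (set (\<rho> # map (case_prod transpose) L)) \<longleftrightarrow> conn {1..d} L"
proof -
  interpret group "sym_group d" by (rule sym_group_is_group)
  let ?S = "set (\<rho> # map (case_prod transpose) L)"
  let ?H = "generate (sym_group d) ?S"
  have "x \<in> {1..d} \<and> y \<in> {1..d}" if "(x, y) \<in> set L" for x y
    using assms(1) that by (auto simp: mono_lists_def)
  then have "transpose x y permutes {1..d}" if "(x, y) \<in> set L" for x y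
    using that by (intro permutes_swap_id) auto
  with assms(2) have S: "?S \<subseteq> carrier (sym_group d)"
    by (auto simp: sym_group_carrier)
  have "generates_transitive d ?S \<longleftrightarrow> (\<forall>x\<in>{1..d}. \<forall>y\<in>{1..d}. \<exists>g\<in>?H. g x = y)"
    unfolding generates_transitive_def transitive_action_def transitive_action_axioms_def
    using restrict_group_action[OF S] by auto
  also have "\<dots> \<longleftrightarrow> conn {1..d} L"
  proof
    have base: "(z, h z) \<in> rel L" if "h \<in> ?S" for h z
    proof (cases "h = \<rho>")
      case True
      have "lprod L (\<rho> z) = z"
        using assms(2,3) by (metis comp_apply id_apply permutes_inv_eq permutes_inv_o(1) permutes_surj surj_f_inv_f)
      with rel_lprod[of "\<rho> z" L] rel_sym True show ?thesis by auto
    next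
      case False
      with that obtain x y where "h = transpose x y" "(x, y) \<in> set L" by auto
      then show ?thesis using rel_edge[of x y L] by (auto simp: transpose_def)
    qed
    have "(z, g z) \<in> rel L" if "g \<in> ?H" for g z
      using that
    proof (induction arbitrary: z)
      case (inv h)
      have hc: "h \<in> carrier (sym_group d)" using inv S by blast
      have "h \<otimes>\<^bsub>sym_group d\<^esub> inv\<^bsub>sym_group d\<^esub> h = \<one>\<^bsub>sym_group d\<^esub>"
        using hc by (rule r_inv)
      then have "h ((inv\<^bsub>sym_group d\<^esub> h) z) = z"
        unfolding sym_group_mult sym_group_one by (metis comp_apply id_apply)
      with base[OF inv, of "(inv\<^bsub>sym_group d\<^esub> h) z"] rel_sym show ?case by auto
    next
      case (eng g h)
      then show ?case unfolding sym_group_mult comp_apply by (blast intro: rel_trans)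
    qed (use base in \<open>auto simp: sym_group_one\<close>)
    then show "\<forall>x\<in>{1..d}. \<forall>y\<in>{1..d}. \<exists>g\<in>?H. g x = y \<Longrightarrow> conn {1..d} L"
      by (fastforce simp: conn_def)
  next
    have "\<exists>g\<in>?H. g x = y" if "(x, y) \<in> rel L" for x y
      using that unfolding rel_def
    proof (induction rule: rtrancl_induct)
      case base
      show ?case using generate.one[of "sym_group d" ?S] by (metis id_apply sym_group_one)
    next
      case (step y z)
      then obtain g where g: "g \<in> ?H" "g x = y" by blast
      \<comment> \<open>A path may run through a pair in either direction; the transposition is the
        same.\<close>
      have "transpose y z \<in> ?S"
        using step(2) by (force simp: transpose_commute)
      then have "transpose y z \<circ> g \<in> ?H"
        using generate.eng[OF generate.incl g(1)] by (metis sym_group_mult)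
      with g show ?case by (intro bexI[of _ "transpose y z \<circ> g"]) auto
    qed
    then show "conn {1..d} L \<Longrightarrow> \<forall>x\<in>{1..d}. \<forall>y\<in>{1..d}. \<exists>g\<in>?H. g x = y"
      by (auto simp: conn_def)
  qed
  finally show ?thesis .
qed

section \<open>Encoding monotone factorizations as a permutation with a list of ordered
  pairs\<close>

lemma inj_on_transpose: "inj_on (case_prod transpose) {(x :: nat, y). x < y}"
proof (rule inj_onI, clarify)
  fix x y x' y' :: nat
  assume h: "x < y" "x' < y'" "transpose x y = transpose x' y'"
  then have "transpose x' y' x = y" "transpose x' y' y = x" by (metis transpose_apply_first, metis transpose_apply_second)
  with h show "x = x' \<and> y = y'" by (auto simp: transpose_def split: if_splits)
qed

lemma foldr_transpose: "foldr (\<circ>) (map (case_prod transpose) L) id = lprod L"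
  by (induction L) auto

text \<open>The total product is the identity exactly when the transpositions multiply to the
  inverse of the first factor; the pairs make the witnesses \<open>A\<close> and \<open>B\<close>
  canonical.\<close>

lemma monotone_factorizations_eq:
  "monotone_factorizations d \<mu> b = (\<lambda>(\<rho>, L). \<rho> # map (case_prod transpose) L) `
    (SIGMA \<rho>:cycle_class d \<mu>. conn_facts {1..d} b (inv' \<rho>))" (is "_ = ?F ` ?D")
proof (intro equalityI subsetI)
  fix \<sigma> assume \<sigma>: "\<sigma> \<in> monotone_factorizations d \<mu> b"
  then obtain A B where
    "\<forall>i\<in>{2..b + 1}. A i < B i \<and> \<sigma> ! (i - 1) = transpose (A i) (B i)"
    "\<forall>i\<in>{2..b}. B i \<le> B (i + 1)"
    unfolding monotone_factorizations_def by blast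
  then have AB: "\<And>i. i \<in> {2..b + 1} \<Longrightarrow> A i < B i"
    "\<And>i. i \<in> {2..b + 1} \<Longrightarrow> \<sigma> ! (i - 1) = transpose (A i) (B i)"
    "\<And>i. i \<in> {2..b} \<Longrightarrow> B i \<le> B (i + 1)"
    by blast+
  from \<sigma> obtain \<rho> \<tau> where \<tau>: "\<sigma> = \<rho> # \<tau>" "length \<tau> = b"
    by (cases \<sigma>) (auto simp: monotone_factorizations_def)
  have \<rho>: "\<rho> \<in> cycle_class d \<mu>" using \<sigma> \<tau> by (simp add: monotone_factorizations_def)
  then have perm: "\<rho> permutes {1..d}" by (simp add: cycle_class_def sym_group_carrier)
  \<comment> \<open>The transpositions are numbered from 2, since number 1 is \<rho>; list positions
    start at 0.\<close>
  define L where "L = map (\<lambda>j. (A (j + 2), B (j + 2))) [0..<b]"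
  have AB': "A (j + 2) < B (j + 2)" "\<tau> ! j = transpose (A (j + 2)) (B (j + 2))"
    "\<tau> ! j \<in> transpositions d" if "j < b" for j
  proof -
    have j: "j + 2 \<in> {2..b + 1}" using that by simp
    show "A (j + 2) < B (j + 2)" using AB(1)[OF j] .
    show "\<tau> ! j = transpose (A (j + 2)) (B (j + 2))" using AB(2)[OF j] by (simp add: \<tau>)
    have "\<sigma> ! (j + 2 - 1) \<in> transpositions d"
      using \<sigma> j unfolding monotone_factorizations_def by blast
    then show "\<tau> ! j \<in> transpositions d" by (simp add: \<tau>)
  qed
  have L: "map (case_prod transpose) L = \<tau>"
    by (rule nth_equalityI) (use AB' \<tau> in \<open>auto simp: L_def\<close>)
  have "sorted (map snd L)"
    unfolding sorted_iff_nth_Suc using AB(3) by (auto simp: L_def)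
  moreover have "A (j + 2) \<in> {1..d} \<and> B (j + 2) \<in> {1..d}" if "j < b" for j
    using AB'[OF that] transpose_in_transpositions by metis
  ultimately have mono: "L \<in> mono_lists {1..d} b"
    using AB'(1) by (force simp: mono_lists_def L_def)
  have prod: "\<rho> \<circ> lprod L = id"
    using \<sigma> by (simp add: monotone_factorizations_def \<tau> sym_group_mult sym_group_one
        foldr_transpose flip: L)
  then have "lprod L = inv' \<rho>"
    using permutes_inv_o(2)[OF perm] by (metis comp_assoc comp_id id_comp)
  moreover have "conn {1..d} L"
    using generates_transitive_iff_conn[OF mono perm prod] \<sigma>
    by (simp add: monotone_factorizations_def \<tau> L)
  ultimately have "(\<rho>, L) \<in> ?D" using mono \<rho> by (simp add: conn_facts_def facts_def)
  moreover have "\<sigma> = ?F (\<rho>, L)" by (simp add: L \<tau>)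
  ultimately show "\<sigma> \<in> ?F ` ?D" by blast
next
  fix \<sigma> assume "\<sigma> \<in> ?F ` ?D"
  then obtain \<rho> L where \<sigma>: "\<sigma> = \<rho> # map (case_prod transpose) L"
    and \<rho>: "\<rho> \<in> cycle_class d \<mu>" and mono: "L \<in> mono_lists {1..d} b"
    and prod: "lprod L = inv' \<rho>" and conn: "conn {1..d} L"
    by (auto simp: conn_facts_def facts_def)
  from \<rho> have perm: "\<rho> permutes {1..d}" by (simp add: cycle_class_def sym_group_carrier)
  then have prod': "\<rho> \<circ> lprod L = id" unfolding prod by (rule permutes_inv_o)
  have len: "length L = b" using mono by (simp add: mono_lists_def)
  \<comment> \<open>The inverse index shift; only the values for \<open>i\<close> from 2 to
    \<open>b + 1\<close> matter.\<close>
  define A B where "A i = fst (L ! (i - 2))" and "B i = snd (L ! (i - 2))" for i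
  have AB: "A i < B i" "\<sigma> ! (i - 1) = transpose (A i) (B i)" "\<sigma> ! (i - 1) \<in> transpositions d"
    if "i \<in> {2..b + 1}" for i
  proof -
    have i: "i - 2 < b" "i - 1 = Suc (i - 2)" using that by auto
    have "L ! (i - 2) \<in> set L" using i len by simp
    then have *: "(A i, B i) \<in> set L" by (simp add: A_def B_def)
    then show 1: "A i < B i" using mono by (auto simp: mono_lists_def)
    show 2: "\<sigma> ! (i - 1) = transpose (A i) (B i)"
      unfolding i(2) using i(1) len by (simp add: \<sigma> A_def B_def case_prod_beta)
    show "\<sigma> ! (i - 1) \<in> transpositions d"
      unfolding 2 transpose_in_transpositions[OF 1] using * mono by (auto simp: mono_lists_def)
  qed
  have "B i \<le> B (i + 1)" if "i \<in> {2..b}" for i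
  proof -
    define j where "j = i - 2"
    have j: "i = j + 2" "Suc j < length L" using that len by (auto simp: j_def)
    then have "map snd L ! j \<le> map snd L ! Suc j"
      using mono by (intro sorted_nth_mono) (auto simp: mono_lists_def)
    then show ?thesis using j by (simp add: B_def)
  qed
  with AB have "\<exists>A B. (\<forall>i\<in>{2..b + 1}. A i < B i \<and> \<sigma> ! (i - 1) = transpose (A i) (B i)) \<and>
      (\<forall>i\<in>{2..b}. B i \<le> B (i + 1))" by blast
  moreover have "generates_transitive d (set \<sigma>)"
    unfolding \<sigma> generates_transitive_iff_conn[OF mono perm prod'] by (rule conn)
  moreover have "foldr (mult (sym_group d)) \<sigma> (one (sym_group d)) = id"
    using prod' by (simp add: \<sigma> sym_group_mult sym_group_one foldr_transpose)
  ultimately show "\<sigma> \<in> monotone_factorizations d \<mu> b"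
    unfolding monotone_factorizations_def using AB(3) \<rho> len by (simp add: \<sigma>)
qed

lemma card_monotone_factorizations:
  "card (monotone_factorizations d \<mu> b) = (\<Sum>\<rho>\<in>cycle_class d \<mu>. card (conn_facts {1..d} b (inv' \<rho>)))"
proof -
  let ?D = "SIGMA \<rho>:cycle_class d \<mu>. conn_facts {1..d} b (inv' \<rho>)"
  have "inj_on (\<lambda>(\<rho>, L). \<rho> # map (case_prod transpose) L) ?D"
  proof (rule inj_onI)
    fix u v assume uv: "u \<in> ?D" "v \<in> ?D"
      "(\<lambda>(\<rho>, L). \<rho> # map (case_prod transpose) L) u = (\<lambda>(\<rho>, L). \<rho> # map (case_prod transpose) L) v"
    obtain \<rho> L \<rho>' M where u: "u = (\<rho>, L)" and v: "v = (\<rho>', M)" by fastforce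
    have "set L \<union> set M \<subseteq> {(x, y). x < y}"
      using uv by (auto simp: u v conn_facts_def facts_def mono_lists_def)
    with uv(3) show "u = v"
      using inj_on_map_eq_map[OF inj_on_subset[OF inj_on_transpose]] by (simp add: u v)
  qed
  then have "card (monotone_factorizations d \<mu> b) = card ?D"
    unfolding monotone_factorizations_eq by (rule card_image)
  also have "\<dots> = (\<Sum>\<rho>\<in>cycle_class d \<mu>. card (conn_facts {1..d} b (inv' \<rho>)))"
  proof (rule card_SigmaI)
    show "finite (cycle_class d \<mu>)"
      using finite_permutations[of "{1..d}"]
      by (rule rev_finite_subset) (auto simp: cycle_class_def sym_group_carrier)
  qed (simp add: conn_facts_def finite_facts)
  finally show ?thesis .
qed

section \<open>Summation over the conjugacy class and the formula for Hurwitz numbers\<close>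

theorem theorem1p1:
  fixes d :: nat and \<mu> :: "nat list"
  assumes "d \<ge> 2" and "partition_of \<mu> d"
  shows "\<exists>C :: nat \<Rightarrow> nat \<Rightarrow> rat. \<forall>g :: nat.
           of_nat (prod_list \<mu>) * monotone_hurwitz g \<mu> =
           (\<Sum>k = 1..d - 1. \<Sum>i = 1..(d - 1) div k.
              C k i * of_nat (2 * g + d + length \<mu> - 2) ^ (i - 1)
                    * of_nat k ^ (2 * g + d + length \<mu> - 2))"
proof -
  define F :: "rat fps" where
    "F = (\<Sum>\<rho>\<in>cycle_class d \<mu>. Abs_fps (\<lambda>b. of_nat (card (conn_facts {1..d} b (inv' \<rho>)))))"
  have "Abs_fps (\<lambda>b. of_nat (card (conn_facts {1..d} b (inv' \<rho>)))) \<in> quasi d" for \<rho>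
    using conn_facts_quasi[of "{1..d}" "inv' \<rho>"] assms(1) by simp
  then have "F \<in> quasi d" unfolding F_def quasi_def by (intro fspan_sum)
  \<comment> \<open>\<open>d + length \<mu>\<close> fixes the parity: the number of transpositions
    differs from it by \<open>2 * g - 2\<close>.\<close>
  from quasi_nth[OF this, of "d + length \<mu>"] obtain C where C:
    "\<And>b. 0 < b \<Longrightarrow> even b = even (d + length \<mu>) \<Longrightarrow>
      F $ b = (\<Sum>k = 1..d - 1. \<Sum>i = 1..(d - 1) div k. C k i * of_nat b ^ (i - 1) * of_nat k ^ b)"
    by blast
  have F: "F $ b = of_nat (card (monotone_factorizations d \<mu> b))" for b
    by (simp add: F_def fps_sum_nth card_monotone_factorizations)
  have sum: "sum_list \<mu> = d" using assms(2) by (simp add: partition_of_def)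
  then have "\<mu> \<noteq> []" using assms(1) by auto
  \<comment> \<open>The normalization does not involve the genus, so it can be absorbed into the
    coefficients.\<close>
  define c :: rat where "c = of_nat (prod_list \<mu>) * (of_nat (aut_card \<mu>) / fact d)"
  have "of_nat (prod_list \<mu>) * monotone_hurwitz g \<mu> =
      (\<Sum>k = 1..d - 1. \<Sum>i = 1..(d - 1) div k.
        c * C k i * of_nat (2 * g + d + length \<mu> - 2) ^ (i - 1)
          * of_nat k ^ (2 * g + d + length \<mu> - 2))" for g
  proof -
    let ?b = "2 * g + d + length \<mu> - 2"
    \<comment> \<open>This avoids the coefficient at 0, for which \<open>quasi_nth\<close> makes no
      claim.\<close>
    have "0 < ?b" using assms(1) \<open>\<mu> \<noteq> []\<close> by (cases \<mu>) auto
    moreover have "even ?b = even (d + length \<mu>)" using assms(1) by auto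
    moreover have "of_nat (prod_list \<mu>) * monotone_hurwitz g \<mu> = c * F $ ?b"
      by (simp add: monotone_hurwitz_def num_transpositions_def sum F c_def)
    ultimately show ?thesis
      by (simp add: C sum_distrib_left mult.assoc)
  qed
  then show ?thesis by (intro exI[of _ "\<lambda>k i. c * C k i"] allI)
qed

end
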